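(* Let $R$ be a ring, $n\ge1$, $k\ge 1$, let $\delta:R\to R$ be an endomorphism and let $T=[t_{i,j}]$ be a transitive matrix in $\mathrm{M}_n(\mathrm{Z}(R))$. Suppose that $R$ satisfies the polynomial identity $$[[[\ldots[[x_1,x_2],x_3],\ldots],x_k],x_{k+1}]=0$$ (i.e. $R$ is Lie nilpotent of index $k$), and let $A\in \mathrm{M}_n(R,\delta,T)$. Write the $k$-th right characteristic polynomial of $A$ as $$p_{A,k}(z)=\mathrm{rdet}_{(k)}(zI_n-A)=\lambda_0^{(k)}+\lambda_1^{(k)}z+\cdots+\lambda_{n^k-1}^{(k)}z^{n^k-1}+\lambda_{n^k}^{(k)}z^{n^k}.$$ Then the right Cayley-Hamilton identity $$(A)p_{A,k}=I_n\lambda_0^{(k)}+A\lambda_1^{(k)}+\cdots+A^{n^k-1}\lambda_{n^k-1}^{(k)}+A^{n^k}\lambda_{n^k}^{(k)}=0$$ holds, and the coefficients $\lambda_i^{(k)}$, $0\le i\le n^k$, are in $\mathrm{Fix}(\delta)$. If moreover $\lambda_{n^k}^{(k)}=n\{(n-1)!\}^{1+n+n^2+\cdots+n^{k-1}}$ is invertible in $R$ and $\mathrm{Fix}(\delta)\subseteq \mathrm{Z}(R)$, then this identity provides the integrality of $\mathrm{M}_n(R,\delta,T)$ over $\mathrm{Z}(R)$ of degree $n^k$ (each $A\in\mathrm{M}_n(R,\delta,T)$ is a root of a monic polynomial of degree $n^k$ with coefficients in $\mathrm{Z}(R)$).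
   Context: A ring means a not necessarily commutative ring with identity; endomorphisms preserve the identity. $\mathrm{Z}(R)$ is the center of $R$, $\mathrm{M}_n(R)$ the ring of $n\times n$ matrices over $R$, $[x,y]=xy-yx$, and $\mathrm{Fix}(\delta)=\{r\in R\mid\delta(r)=r\}$. For a matrix $X$ over $R$ and $\lambda\in R$, $X\lambda$ is the matrix obtained by multiplying each entry of $X$ by $\lambda$ on the right. A matrix $T=[t_{i,j}]$ is transitive if $t_{i,i}=1$ and $t_{i,j}t_{j,l}=t_{i,l}$ for all $i,j,l\in\{1,\ldots,n\}$. The supermatrix algebra is $$\mathrm{M}_n(R,\delta,T)=\{A=[a_{i,j}]\in\mathrm{M}_n(R)\mid \delta(a_{i,j})=t_{i,j}a_{i,j}\text{ for all }1\le i,j\le n\}.$$ For any ring $S$ and $A=[a_{i,j}]\in\mathrm{M}_n(S)$, the preadjoint $A^{\ast}=[a^{\ast}_{r,s}]$ is defined by $$a_{r,s}^{\ast}=\sum_{\tau,\pi}\mathrm{sgn}(\pi)\,a_{\tau(1),\pi(\tau(1))}\cdots a_{\tau(s-1),\pi(\tau(s-1))}\,a_{\tau(s+1),\pi(\tau(s+1))}\cdots a_{\tau(n),\pi(\tau(n))},$$ the sum being over all $\tau,\pi\in\mathrm{S}_n$ with $\tau(s)=s$, $\pi(s)=r$ (an empty product is $1$). The right adjoint sequence of $A$ is $P_1=A^{\ast}$, $P_{m+1}=(AP_1\cdots P_m)^{\ast}$ for $m\ge1$, and the $k$-th right determinant is $\mathrm{rdet}_{(k)}(A)=\mathrm{tr}(AP_1\cdots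 P_k)$, where $\mathrm{tr}$ is the sum of the diagonal entries. $R[z]$ is the polynomial ring in one commuting indeterminate; $\mathrm{rdet}_{(k)}(zI_n-A)$ is computed in $\mathrm{M}_n(R[z])$, and it is a polynomial of the displayed form with $\lambda_i^{(k)}\in R$ and $\lambda_{n^k}^{(k)}=n\{(n-1)!\}^{1+n+n^2+\cdots+n^{k-1}}$. *)

theory Defs
  imports "Jordan_Normal_Form.Matrix" "HOL-Library.Poly_Mapping"
    "HOL-Combinatorics.Permutations"
begin

text \<open>
  The base ring is a type of class \<^class>\<open>ring_1\<close>, not assumed commutative.  Its polynomial ring
  in one commuting indeterminate is \<open>nat \<Rightarrow>\<^sub>0 'a\<close> (finitely supported functions under
  convolution); the type \<open>'a poly\<close> has a multiplication only for commutative coefficients.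
  Here \<open>Poly_Mapping.single i c\<close> is the monomial \<open>c z^i\<close> and \<open>Poly_Mapping.lookup p i\<close> is the
  coefficient of \<open>z^i\<close>.  Matrix indices run over \<open>{0..<n}\<close> in place of \<open>{1..n}\<close>.
\<close>

definition ring_center :: "'a::ring_1 set" where
  "ring_center = {c. \<forall>x. c * x = x * c}"

definition Fix :: "('a \<Rightarrow> 'a) \<Rightarrow> 'a set" where
  "Fix \<delta> = {r. \<delta> r = r}"

definition commutator :: "'a::ring_1 \<Rightarrow> 'a \<Rightarrow> 'a" where
  "commutator x y = x * y - y * x"

text \<open>With \<open>x = x\<^sub>1\<close> and \<open>xs = [x\<^sub>2, \<dots>, x\<^sub>k\<^sub>+\<^sub>1]\<close>, the fold is the
  left-normed commutator of \<open>x\<^sub>1, \<dots>, x\<^sub>k\<^sub>+\<^sub>1\<close>.\<close>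
definition lie_nilpotent :: "'a::ring_1 itself \<Rightarrow> nat \<Rightarrow> bool" where
  "lie_nilpotent _ k \<longleftrightarrow> (\<forall>(x::'a) xs. length xs = k \<longrightarrow> foldl commutator x xs = 0)"

definition transitive_mat :: "nat \<Rightarrow> 'a::ring_1 mat \<Rightarrow> bool" where
  "transitive_mat n T \<longleftrightarrow> T \<in> carrier_mat n n \<and> (\<forall>i<n. T $$ (i, i) = 1) \<and>
     (\<forall>i<n. \<forall>j<n. \<forall>l<n. T $$ (i, j) * T $$ (j, l) = T $$ (i, l))"

definition supermatrix_algebra :: "nat \<Rightarrow> ('a::ring_1 \<Rightarrow> 'a) \<Rightarrow> 'a mat \<Rightarrow> 'a mat set" where
  "supermatrix_algebra n \<delta> T =
     {A \<in> carrier_mat n n. \<forall>i<n. \<forall>j<n. \<delta> (A $$ (i, j)) = T $$ (i, j) * A $$ (i, j)}"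

definition mat_trace :: "'a::comm_monoid_add mat \<Rightarrow> 'a" where
  "mat_trace A = (\<Sum>i<dim_row A. A $$ (i, i))"

definition preadjoint :: "'a::ring_1 mat \<Rightarrow> 'a mat" where
  "preadjoint A = (let n = dim_row A in mat n n (\<lambda>(r, s).
     \<Sum>(\<tau>, \<pi>) \<in> {(\<tau>, \<pi>). \<tau> permutes {..<n} \<and> \<pi> permutes {..<n} \<and> \<tau> s = s \<and> \<pi> s = r}.
       of_int (sign \<pi>) * prod_list (map (\<lambda>i. A $$ (\<tau> i, \<pi> (\<tau> i))) ([0..<s] @ [Suc s..<n]))))"

text \<open>\<open>right_adjoint A m\<close> is \<open>P\<^sub>m\<^sub>+\<^sub>1\<close>, and \<open>right_adjoint_prod A m\<close> is
  \<open>A P\<^sub>1 \<cdots> P\<^sub>m\<close>.\<close>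
fun right_adjoint :: "'a::ring_1 mat \<Rightarrow> nat \<Rightarrow> 'a mat"
  and right_adjoint_prod :: "'a::ring_1 mat \<Rightarrow> nat \<Rightarrow> 'a mat" where
  "right_adjoint A m = preadjoint (right_adjoint_prod A m)"
| "right_adjoint_prod A 0 = A"
| "right_adjoint_prod A (Suc m) = right_adjoint_prod A m * right_adjoint A m"

definition rdet :: "nat \<Rightarrow> 'a::ring_1 mat \<Rightarrow> 'a" where
  "rdet k A = mat_trace (right_adjoint_prod A k)"

definition right_char_poly :: "nat \<Rightarrow> 'a::ring_1 mat \<Rightarrow> (nat \<Rightarrow>\<^sub>0 'a)" where
  "right_char_poly k A =
     rdet k (Poly_Mapping.single 1 1 \<cdot>\<^sub>m 1\<^sub>m (dim_row A) - map_mat (Poly_Mapping.single 0) A)"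

text \<open>The library's \<open>\<cdot>\<^sub>m\<close> multiplies entries by a scalar on the left.\<close>
definition right_smult_mat :: "'a::ring_1 mat \<Rightarrow> 'a \<Rightarrow> 'a mat" (infixl \<open>\<cdot>\<^sub>r\<close> 70) where
  "X \<cdot>\<^sub>r c = map_mat (\<lambda>x. x * c) X"

definition right_subst :: "'a::ring_1 mat \<Rightarrow> (nat \<Rightarrow>\<^sub>0 'a) \<Rightarrow> 'a mat" where
  "right_subst A p = finsum (ring_mat TYPE('a) (dim_row A) ())
     (\<lambda>i. (A ^\<^sub>m i) \<cdot>\<^sub>r Poly_Mapping.lookup p i) (Poly_Mapping.keys p)"

end

theory Submission
  imports Defs "HOL-Combinatorics.Multiset_Permutations"
begin

text \<open>
  Off-diagonal entries and differences of diagonal entries of \<open>A P\<^sub>1\<close> are sums of commutators, by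
  rotating the words in \<open>A A\<^sup>*\<close> cyclically.  Hence all entries of \<open>A P\<^sub>1\<close> lie in the subring \<open>S\<close>
  generated by one diagonal entry and all commutators, and \<open>A P\<^sub>1\<close> is scalar modulo
  \<open>N\<^sub>1 = S L\<^sub>1 + R L\<^sub>2\<close>, where \<open>L\<^sub>j\<close> is the additive group of sums of left-normed commutators of
  \<open>j + 1\<close> elements.  For \<open>N\<^sub>j = S L\<^sub>j + R L\<^sub>j\<^sub>+\<^sub>1\<close> one has \<open>[S, N\<^sub>j] \<subseteq> N\<^sub>j\<^sub>+\<^sub>1\<close>, so a matrix over \<open>S\<close>
  that is scalar modulo \<open>N\<^sub>j\<close> has entries commuting modulo \<open>N\<^sub>j\<^sub>+\<^sub>1\<close>, and multiplying it by its
  preadjoint makes it scalar modulo \<open>N\<^sub>j\<^sub>+\<^sub>1\<close>.  If \<open>R\<close> is Lie nilpotent of index \<open>k\<close> then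
  \<open>N\<^sub>k = 0\<close>, so \<open>A P\<^sub>1 \<cdots> P\<^sub>k\<close> is a scalar matrix \<open>b I\<close>.

  Applied to \<open>zI - A\<close> over \<open>R[z]\<close>, which is again Lie nilpotent of index \<open>k\<close>, this gives
  \<open>(zI - A) Q = b I\<close> with \<open>p = n b\<close>, and the Cayley-Hamilton identity follows by comparing
  coefficients.  The coefficients are fixed by \<open>\<delta>\<close> because a product of \<open>t\<^sub>i\<^sub>,\<^sub>\<pi>\<^sub>(\<^sub>i\<^sub>)\<close> over all \<open>i\<close>
  equals 1 for a transitive matrix.
\<close>

section \<open>The filtration\<close>

inductive_set add_span :: "'a::ring_1 set \<Rightarrow> 'a set" for X where
  zero: "0 \<in> add_span X"
| base: "x \<in> X \<Longrightarrow> x \<in> add_span X"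
| diff: "x \<in> add_span X \<Longrightarrow> y \<in> add_span X \<Longrightarrow> x - y \<in> add_span X"

definition add_subgroup :: "'a::ring_1 set \<Rightarrow> bool" where
  "add_subgroup G \<longleftrightarrow> 0 \<in> G \<and> (\<forall>x\<in>G. \<forall>y\<in>G. x - y \<in> G)"

lemma add_subgroup_add_span [simp]: "add_subgroup (add_span X)"
  by (auto simp: add_subgroup_def intro: add_span.intros)

lemma add_span_least: "add_subgroup G \<Longrightarrow> X \<subseteq> G \<Longrightarrow> add_span X \<subseteq> G"
proof
  fix x assume "add_subgroup G" "X \<subseteq> G" "x \<in> add_span X"
  from this(3,1,2) show "x \<in> G"
    by (induction rule: add_span.induct) (auto simp: add_subgroup_def)
qed

lemma add_subgroupD:
  assumes "add_subgroup G"
  shows add_subgroup_zero: "0 \<in> G"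
    and add_subgroup_diff: "x \<in> G \<Longrightarrow> y \<in> G \<Longrightarrow> x - y \<in> G"
    and add_subgroup_uminus: "x \<in> G \<Longrightarrow> - x \<in> G"
    and add_subgroup_add: "x \<in> G \<Longrightarrow> y \<in> G \<Longrightarrow> x + y \<in> G"
proof -
  show 0: "0 \<in> G" and d: "x \<in> G \<Longrightarrow> y \<in> G \<Longrightarrow> x - y \<in> G" for x y
    using assms by (auto simp: add_subgroup_def)
  show m: "x \<in> G \<Longrightarrow> - x \<in> G" for x
    using d[OF 0, of x] by simp
  show "x \<in> G \<Longrightarrow> y \<in> G \<Longrightarrow> x + y \<in> G"
    using d[of x "- y"] m by simp
qed

lemma add_subgroup_sum:
  "add_subgroup G \<Longrightarrow> (\<And>i. i \<in> I \<Longrightarrow> f i \<in> G) \<Longrightarrow> sum f I \<in> G"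
  by (induction I rule: infinite_finite_induct) (auto intro: add_subgroup_zero add_subgroup_add)

lemma add_subgroup_of_int_mult:
  assumes G: "add_subgroup G" and x: "x \<in> G"
  shows "of_int m * x \<in> G"
proof (induction m rule: int_induct[where k = 0])
  case base then show ?case using add_subgroup_zero[OF G] by simp
next
  case (step1 i)
  then show ?case using add_subgroup_add[OF G _ x, of "of_int i * x"]
    by (simp add: distrib_right add.commute)
next
  case (step2 i)
  then show ?case using add_subgroup_diff[OF G _ x] by (simp add: left_diff_distrib)
qed

lemma add_subgroup_vimage:
  assumes "add_subgroup G" and "\<And>x y. f (x - y) = f x - f y"
  shows "add_subgroup {x. f x \<in> G}"
proof -
  have "f 0 = 0" using assms(2)[of 0 0] by simp
  with assms show ?thesis by (simp add: add_subgroup_def)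
qed

text \<open>The preimage of \<open>G\<close> under the additive map \<open>f\<close> is a subgroup,
  so it contains the span as soon as it contains \<open>X\<close>. Additivity is stated for
  differences because \<open>add_span\<close> is closed by differences.\<close>

lemma add_span_map_induct:
  assumes "x \<in> add_span X" and "add_subgroup G" and "\<And>x y. f (x - y) = f x - f y"
    and "\<And>x. x \<in> X \<Longrightarrow> f x \<in> G"
  shows "f x \<in> G"
  using add_span_least[OF add_subgroup_vimage[OF assms(2,3)], of X] assms(1,4) by auto

section \<open>Commutator identities and the lower central series\<close>

lemma commutator_diff_left: "commutator (x - y) z = commutator x z - commutator y z"
  and commutator_diff_right: "commutator z (x - y) = commutator z x - commutator z y"
  and commutator_swap: "commutator x y = - commutator y x"
  and commutator_mult_left: "commutator (x * y) z = x * commutator y z + commutator x z * y"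
  and commutator_mult_right: "commutator z (x * y) = commutator z x * y + x * commutator z y"
  by (simp_all add: commutator_def algebra_simps)

text \<open>The lower central series of the ring regarded as a Lie ring, that is
  \<open>L\<^sub>j\<close>. Numbering starts at 0, so the index counts brackets. The terms are
  additive groups, not ideals.\<close>

primrec lcs :: "nat \<Rightarrow> 'a::ring_1 set" where
  "lcs 0 = UNIV"
| "lcs (Suc j) = add_span {commutator x y |x y. x \<in> lcs j}"

declare lcs.simps(2) [simp del]

lemma add_subgroup_lcs: "add_subgroup (lcs j)"
  by (cases j) (auto simp: add_subgroup_def lcs.simps intro: add_span.intros)

lemma commutator_lcs: "x \<in> lcs j \<Longrightarrow> commutator x y \<in> lcs (Suc j)"
  by (auto simp: lcs.simps intro: add_span.base)

lemma commutator_lcs': "x \<in> lcs j \<Longrightarrow> commutator y x \<in> lcs (Suc j)"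
  using commutator_lcs[of x j y] commutator_swap[of y x] add_subgroup_uminus[OF add_subgroup_lcs]
  by metis

lemma lcs_Suc_subset: "lcs (Suc j) \<subseteq> (lcs j :: 'a::ring_1 set)"
proof (induction j)
  case (Suc j)
  have "add_span {commutator x y |x y. x \<in> lcs (Suc j)} \<subseteq> (lcs (Suc j) :: 'a set)"
    using Suc by (intro add_span_least add_subgroup_lcs) (auto intro!: commutator_lcs)
  then show ?case by (simp only: lcs.simps(2))
qed simp

text \<open>By the Jacobi identity, bracketing with a commutator counts as two brackets.\<close>

lemma commutator_lcs_commutator:
  "w \<in> lcs j \<Longrightarrow> commutator w (commutator a b) \<in> lcs (Suc (Suc j))"
proof -
  assume w: "w \<in> lcs j"
  have "commutator w (commutator a b)
      = commutator (commutator w a) b - commutator (commutator w b) a"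
    by (simp add: commutator_def algebra_simps)
  with w show ?thesis
    by (metis add_subgroup_diff[OF add_subgroup_lcs] commutator_lcs)
qed

text \<open>The left-normed commutator is additive in its first argument, so the identity extends
  from single commutators to their sums.\<close>

lemma lie_nilpotent_lcs:
  assumes "lie_nilpotent TYPE('a::ring_1) k"
  shows "lcs k = {0::'a}"
proof -
  have fold_diff: "foldl commutator (x - y) zs = foldl commutator x zs - foldl commutator y zs"
    for x y :: 'a and zs
    by (induction zs arbitrary: x y) (simp_all add: commutator_diff_left)
  \<comment> \<open>Of the \<open>k\<close> brackets, \<open>j\<close> are already taken inside
    \<open>lcs j\<close> and the fold takes the rest. The case \<open>j = 0\<close> is the
    hypothesis, and an empty list gives the claim.\<close>
  have "foldl commutator x zs = 0" if "x \<in> lcs j" "j + length zs = k" for x :: 'a and j zs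
    using that
  proof (induction j arbitrary: x zs)
    case 0 then show ?case using assms by (simp add: lie_nilpotent_def)
  next
    case (Suc j)
    have "foldl commutator x zs \<in> {0}"
    proof (rule add_span_map_induct[where f = "\<lambda>x. foldl commutator x zs"])
      show "x \<in> add_span {commutator x y |x y. x \<in> lcs j}"
        using Suc.prems(1) by (simp only: lcs.simps)
    next
      fix v :: 'a assume "v \<in> {commutator x y |x y. x \<in> lcs j}"
      then obtain a b where "v = commutator a b" "a \<in> lcs j" by blast
      with Suc.IH[of a "b # zs"] Suc.prems(2) show "foldl commutator v zs \<in> {0}" by simp
    qed (simp_all add: add_subgroup_def fold_diff)
    then show ?case by simp
  qed
  from this[of _ k "[]"] have "lcs k \<subseteq> {0::'a}" by auto
  then show ?thesis using add_subgroup_zero[OF add_subgroup_lcs, of k] by auto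
qed

section \<open>The subring generated by one element and all commutators, and its filtration\<close>

text \<open>This is \<open>S\<close>, with \<open>c\<close> to become a diagonal entry of
  \<open>A P\<^sub>1\<close>. Commutators of arbitrary ring elements are generators, and
  \<open>c\<close> is the only further one besides 1.\<close>

inductive_set comm_subring :: "'a::ring_1 \<Rightarrow> 'a set" for c where
  gen: "c \<in> comm_subring c"
| comm: "commutator x y \<in> comm_subring c"
| one: "1 \<in> comm_subring c"
| diff: "x \<in> comm_subring c \<Longrightarrow> y \<in> comm_subring c \<Longrightarrow> x - y \<in> comm_subring c"
| mult: "x \<in> comm_subring c \<Longrightarrow> y \<in> comm_subring c \<Longrightarrow> x * y \<in> comm_subring c"

lemma add_subgroup_comm_subring: "add_subgroup (comm_subring c)"
  using comm_subring.diff[OF comm_subring.one comm_subring.one]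
  by (auto simp: add_subgroup_def intro: comm_subring.diff)

lemma lcs_1_subset: "lcs 1 \<subseteq> comm_subring c"
proof -
  have "add_span {commutator x y |x y. x \<in> lcs 0} \<subseteq> comm_subring c"
    by (intro add_span_least add_subgroup_comm_subring) (auto intro: comm_subring.comm)
  then show ?thesis by (simp add: lcs.simps)
qed

text \<open>With coefficients from the whole ring instead of \<open>comm_subring c\<close> the bracket would not
  raise the filtration degree; the second summand absorbs the coefficients that leave the subring.\<close>
definition comm_filt :: "'a::ring_1 \<Rightarrow> nat \<Rightarrow> 'a set" where
  "comm_filt c j = add_span ({s * l |s l. s \<in> comm_subring c \<and> l \<in> lcs j} \<union>
     {r * l |r l. l \<in> lcs (Suc j)})"

lemma add_subgroup_comm_filt: "add_subgroup (comm_filt c j)"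
  by (simp add: comm_filt_def)

lemma comm_filt_sub: "s \<in> comm_subring c \<Longrightarrow> l \<in> lcs j \<Longrightarrow> s * l \<in> comm_filt c j"
  and comm_filt_any: "l \<in> lcs (Suc j) \<Longrightarrow> r * l \<in> comm_filt c j"
  unfolding comm_filt_def by (rule add_span.base, blast)+

lemma lcs_subset_comm_filt: "lcs j \<subseteq> comm_filt c j"
  using comm_filt_sub[OF comm_subring.one] by auto

lemma comm_filt_map_induct:
  assumes "x \<in> comm_filt c j" and "add_subgroup G" and "\<And>x y. f (x - y) = f x - f y"
    and "\<And>s l. s \<in> comm_subring c \<Longrightarrow> l \<in> lcs j \<Longrightarrow> f (s * l) \<in> G"
    and "\<And>r l. l \<in> lcs (Suc j) \<Longrightarrow> f (r * l) \<in> G"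
  shows "f x \<in> G"
  by (rule add_span_map_induct[OF assms(1)[unfolded comm_filt_def] assms(2,3)])
    (use assms(4,5) in auto)

lemma comm_filt_mult_left:
  assumes "u \<in> comm_subring c" and "x \<in> comm_filt c j"
  shows "u * x \<in> comm_filt c j"
  using assms(2)
  by (rule comm_filt_map_induct[OF _ add_subgroup_comm_filt])
    (auto simp: right_diff_distrib mult.assoc[symmetric] intro: comm_filt_sub comm_filt_any
      comm_subring.mult assms)

text \<open>Moving \<open>u\<close> to the left past \<open>l\<close> costs \<open>[l, u]\<close>,
  which lies one step deeper in \<open>lcs\<close>, where any coefficient is allowed.\<close>

lemma comm_filt_mult_right:
  assumes "u \<in> comm_subring c" and "x \<in> comm_filt c j"
  shows "x * u \<in> comm_filt c j"
  using assms(2)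
proof (rule comm_filt_map_induct[OF _ add_subgroup_comm_filt])
  have eq: "s * l * u = s * u * l + s * commutator l u" for s l
    by (simp add: commutator_def algebra_simps)
  show "s * l * u \<in> comm_filt c j" if "s \<in> comm_subring c" "l \<in> lcs j" for s l
    unfolding eq
    by (intro add_subgroup_add[OF add_subgroup_comm_filt] comm_filt_sub comm_filt_any
        comm_subring.mult commutator_lcs that assms)
  show "r * l * u \<in> comm_filt c j" if "l \<in> lcs (Suc j)" for r l
    unfolding eq
    by (intro add_subgroup_add[OF add_subgroup_comm_filt] comm_filt_any that)
      (use commutator_lcs[OF that] lcs_Suc_subset in blast)
qed (simp add: left_diff_distrib)

text \<open>The identity expands \<open>[[w, d t], z]\<close> by the Leibniz rule and solves for \<open>[d, z] [w, t]\<close>; the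
  term \<open>[[w, d], z] t\<close> has a coefficient outside the subring, but one bracket to spare since \<open>d\<close> is
  itself a commutator.\<close>
lemma commutator_commutator_mult_lcs:
  fixes a b z :: "'a::ring_1"
  assumes "v \<in> lcs (Suc j)"
  shows "commutator (commutator a b) z * v \<in> comm_filt c (Suc (Suc j))"
proof (rule add_span_map_induct[OF assms[unfolded lcs.simps] add_subgroup_comm_filt])
  let ?d = "commutator a b"
  let ?J = "comm_filt c (Suc (Suc j))"
  fix v :: 'a assume "v \<in> {commutator x y |x y. x \<in> lcs j}"
  then obtain w t where v: "v = commutator w t" and w: "w \<in> lcs j" by blast
  have eq: "commutator ?d z * v =
      1 * commutator (commutator w (?d * t)) z - ?d * commutator (commutator w t) z
      - (t * commutator (commutator w ?d) z + 1 * commutator (commutator (commutator w ?d) z) t)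
      - (commutator t z * commutator w ?d + 1 * commutator (commutator w ?d) (commutator t z))"
    unfolding v by (simp add: commutator_def algebra_simps)
  have wd: "commutator w ?d \<in> lcs (Suc (Suc j))" by (rule commutator_lcs_commutator[OF w])
  have wdz: "commutator (commutator w ?d) z \<in> lcs (Suc (Suc (Suc j)))"
    by (rule commutator_lcs[OF wd])
  have wdz': "commutator (commutator (commutator w ?d) z) t \<in> lcs (Suc (Suc (Suc j)))"
    using commutator_lcs[OF wdz] lcs_Suc_subset by blast
  show "commutator ?d z * v \<in> ?J"
    unfolding eq
    by (intro add_subgroup_diff[OF add_subgroup_comm_filt] add_subgroup_add[OF add_subgroup_comm_filt]
        comm_filt_any[OF wdz] comm_filt_any[OF wdz'] comm_filt_any[OF commutator_lcs[OF wd]]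
        comm_filt_sub comm_subring.one comm_subring.comm wd commutator_lcs w)
qed (simp add: right_diff_distrib)

text \<open>The Leibniz rule reduces both arguments of the bracket to generators. A bracket with a
  commutator is covered by the preceding lemma, and the one remaining pair gives
  \<open>[c, c] = 0\<close>; this is why \<open>S\<close> has a single generator that is not a
  commutator.\<close>

lemma commutator_comm_subring_mult_lcs:
  assumes "s \<in> comm_subring c" and "u \<in> comm_subring c" and "l \<in> lcs (Suc j)"
  shows "commutator s u * l \<in> comm_filt c (Suc (Suc j))"
proof -
  let ?J = "comm_filt c (Suc (Suc j))"
  note J = add_subgroup_comm_filt[of c "Suc (Suc j)"]
  \<comment> \<open>The Leibniz rule leaves terms with a factor \<open>y\<close> between the bracket
    and \<open>l\<close>. It is moved to the right of \<open>l\<close>, at the cost of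
    \<open>x [y, l]\<close>.\<close>
  have shift: "x * y * l \<in> ?J"
    if "\<And>l. l \<in> lcs (Suc j) \<Longrightarrow> x * l \<in> ?J" "x \<in> comm_subring c" "y \<in> comm_subring c"
      "l \<in> lcs (Suc j)" for x y l
  proof -
    have "x * y * l = x * l * y + x * commutator y l"
      by (simp add: commutator_def algebra_simps)
    then show ?thesis
      using that by (simp add: add_subgroup_add[OF J] comm_filt_mult_right comm_filt_sub
          commutator_lcs')
  qed
  have with_c: "commutator s c * l \<in> ?J" if "s \<in> comm_subring c" "l \<in> lcs (Suc j)" for s l
    using that
  proof (induction arbitrary: l rule: comm_subring.induct)
    case gen
    then show ?case using add_subgroup_zero[OF J] by (simp add: commutator_def)
  next
    case (comm x y)
    then show ?case by (intro commutator_commutator_mult_lcs)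
  next
    case one
    then show ?case using add_subgroup_zero[OF J] by (simp add: commutator_def)
  next
    case (diff x y)
    then show ?case
      by (simp add: commutator_diff_left left_diff_distrib add_subgroup_diff[OF J])
  next
    case (mult x y)
    have "x * (commutator y c * l) + commutator x c * y * l \<in> ?J"
      using mult by (simp add: add_subgroup_add[OF J] comm_filt_mult_left shift comm_subring.comm)
    then show ?case by (simp add: commutator_mult_left distrib_right mult.assoc)
  qed
  show ?thesis
    using assms(2,3)
  proof (induction arbitrary: l rule: comm_subring.induct)
    case gen
    then show ?case using assms(1) by (intro with_c)
  next
    case (comm x y)
    have "- (commutator (commutator x y) s * l) \<in> ?J"
      using comm by (intro add_subgroup_uminus[OF J] commutator_commutator_mult_lcs)
    then show ?case by (subst commutator_swap) simp
  next
    case one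
    then show ?case using add_subgroup_zero[OF J] by (simp add: commutator_def)
  next
    case (diff x y)
    then show ?case
      by (simp add: commutator_diff_right left_diff_distrib add_subgroup_diff[OF J])
  next
    case (mult x y)
    have "commutator s x * y * l + x * (commutator s y * l) \<in> ?J"
      using mult by (simp add: add_subgroup_add[OF J] comm_filt_mult_left shift comm_subring.comm)
    then show ?case by (simp add: commutator_mult_right distrib_right mult.assoc)
  qed
qed

text \<open>Both kinds of generators are treated by the Leibniz rule. For \<open>s l\<close> the
  term \<open>[u, s] l\<close> is the preceding lemma, which requires \<open>l\<close> to contain at
  least one bracket, hence the index \<open>Suc j\<close>. For \<open>r l\<close> the coefficient
  \<open>[u, r]\<close> lies in \<open>S\<close> although \<open>r\<close> is arbitrary, and
  \<open>[u, l]\<close> gains a bracket.\<close>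

lemma commutator_comm_filt:
  assumes u: "u \<in> comm_subring c" and "x \<in> comm_filt c (Suc j)"
  shows "commutator u x \<in> comm_filt c (Suc (Suc j))"
  using assms(2)
proof (rule comm_filt_map_induct[OF _ add_subgroup_comm_filt])
  note J = add_subgroup_comm_filt[of c "Suc (Suc j)"]
  show "commutator u (s * l) \<in> comm_filt c (Suc (Suc j))"
    if "s \<in> comm_subring c" "l \<in> lcs (Suc j)" for s l
    unfolding commutator_mult_right
    by (intro add_subgroup_add[OF J] commutator_comm_subring_mult_lcs comm_filt_sub
        commutator_lcs' that u)
  show "commutator u (r * l) \<in> comm_filt c (Suc (Suc j))" if "l \<in> lcs (Suc (Suc j))" for r l
    unfolding commutator_mult_right
    by (intro add_subgroup_add[OF J] comm_filt_sub comm_filt_any comm_subring.comm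
        commutator_lcs' that)
qed (simp add: commutator_diff_right)

lemma comm_filt_eq_zero:
  fixes c :: "'a::ring_1"
  assumes "lcs j = {0::'a}"
  shows "comm_filt c j = {0}"
proof -
  have "lcs (Suc j) \<subseteq> {0::'a}" using lcs_Suc_subset[of j, where 'a = 'a] assms by simp
  then have "comm_filt c j \<subseteq> {0}"
    unfolding comm_filt_def assms
    by (intro add_span_least) (auto simp: add_subgroup_def)
  then show ?thesis using add_subgroup_zero[OF add_subgroup_comm_filt, of c j] by auto
qed

section \<open>Preadjoints as sums over words\<close>

text \<open>The list \<rho> records the order in which the rows are multiplied, separately from the
  choice of columns by \<pi>. A list can be cut and rotated, which the permutation \<tau> of the
  preadjoint cannot so directly.\<close>

definition word :: "'a::ring_1 mat \<Rightarrow> (nat \<Rightarrow> nat) \<Rightarrow> nat list \<Rightarrow> 'a" where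
  "word A \<pi> \<rho> = prod_list (map (\<lambda>i. A $$ (i, \<pi> i)) \<rho>)"

lemma word_simps [simp]:
  "word A \<pi> [] = 1"
  "word A \<pi> (i # \<rho>) = A $$ (i, \<pi> i) * word A \<pi> \<rho>"
  "word A \<pi> (\<rho> @ \<rho>') = word A \<pi> \<rho> * word A \<pi> \<rho>'"
  by (simp_all add: word_def)

lemma word_cong: "(\<And>i. i \<in> set \<rho> \<Longrightarrow> \<pi> i = \<pi>' i) \<Longrightarrow> word A \<pi> \<rho> = word A \<pi>' \<rho>"
  by (simp add: word_def cong: map_cong)

lemma preadjoint_carrier [simp]: "A \<in> carrier_mat n n \<Longrightarrow> preadjoint A \<in> carrier_mat n n"
  by (simp add: preadjoint_def Let_def)

lemma right_adjoint_prod_carrier [simp]: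
  "A \<in> carrier_mat n n \<Longrightarrow> right_adjoint_prod A m \<in> carrier_mat n n"
  by (induction m) auto

text \<open>A permutation fixing \<open>s\<close> is determined by the list of its other values.
  Surjectivity follows by counting: both sides have \<open>fact (n - 1)\<close> elements.\<close>

lemma bij_betw_orderings:
  assumes "s < n"
  shows "bij_betw (\<lambda>\<tau>. map \<tau> ([0..<s] @ [Suc s..<n])) {\<tau>. \<tau> permutes {..<n} \<and> \<tau> s = s}
    (permutations_of_set ({..<n} - {s}))"
proof -
  let ?X = "{..<n} - {s}" and ?xs = "[0..<s] @ [Suc s..<n]"
  let ?f = "\<lambda>\<tau>::nat \<Rightarrow> nat. map \<tau> ?xs"
  have X: "set ?xs = ?X" and dist: "distinct ?xs"
    using assms by auto
  have fixing: "{\<tau>. \<tau> permutes {..<n} \<and> \<tau> s = s} = {\<tau>. \<tau> permutes ?X}"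
    using permutes_superset[of _ "{..<n}" ?X] permutes_subset[of _ ?X "{..<n}"]
      permutes_not_in[of _ ?X s] by auto
  have inj: "inj_on ?f {\<tau>. \<tau> permutes ?X}"
  proof (intro inj_onI ext)
    fix \<tau> \<tau>' :: "nat \<Rightarrow> nat" and i
    assume p: "\<tau> \<in> {\<tau>. \<tau> permutes ?X}" "\<tau>' \<in> {\<tau>. \<tau> permutes ?X}" and eq: "?f \<tau> = ?f \<tau>'"
    show "\<tau> i = \<tau>' i"
    proof (cases "i \<in> ?X")
      case True
      then show ?thesis using eq X by (metis map_eq_conv)
    next
      case False
      then show ?thesis using p permutes_not_in by (metis mem_Collect_eq)
    qed
  qed
  have sub: "?f ` {\<tau>. \<tau> permutes ?X} \<subseteq> permutations_of_set ?X"
  proof clarify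
    fix \<tau> assume "\<tau> permutes ?X"
    then show "?f \<tau> \<in> permutations_of_set ?X"
      using X dist by (intro permutations_of_setI)
        (simp_all only: set_map permutes_image distinct_map permutes_inj_on)
  qed
  have "card (?f ` {\<tau>. \<tau> permutes ?X}) = card (permutations_of_set ?X)"
    using card_permutations[of ?X "n - 1"] assms by (simp only: card_image[OF inj]) simp
  with sub inj show ?thesis
    unfolding fixing bij_betw_def using card_subset_eq[OF finite_permutations_of_set] by blast
qed

lemma preadjoint_index:
  assumes "A \<in> carrier_mat n n" and "r < n" and s: "s < n"
  shows "preadjoint A $$ (r, s) = (\<Sum>\<rho>\<in>permutations_of_set ({..<n} - {s}).
    \<Sum>\<pi> | \<pi> permutes {..<n} \<and> \<pi> s = r. of_int (sign \<pi>) * word A \<pi> \<rho>)"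
proof -
  let ?P = "{\<pi>. \<pi> permutes {..<n} \<and> \<pi> s = r}"
  let ?f = "\<lambda>\<tau>. map \<tau> ([0..<s] @ [Suc s..<n])"
  have pairs: "{(\<tau>, \<pi>). \<tau> permutes {..<n} \<and> \<pi> permutes {..<n} \<and> \<tau> s = s \<and> \<pi> s = r}
      = {\<tau>. \<tau> permutes {..<n} \<and> \<tau> s = s} \<times> ?P"
    by auto
  have "preadjoint A $$ (r, s) = (\<Sum>(\<tau>, \<pi>) \<in> {\<tau>. \<tau> permutes {..<n} \<and> \<tau> s = s} \<times> ?P.
      of_int (sign \<pi>) * word A \<pi> (?f \<tau>))"
    using assms unfolding preadjoint_def pairs[symmetric]
    by (simp add: word_def Let_def o_def)
  also have "\<dots> = (\<Sum>\<tau> | \<tau> permutes {..<n} \<and> \<tau> s = s. \<Sum>\<pi>\<in>?P. of_int (sign \<pi>) * word A \<pi> (?f \<tau>))"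
    by (rule sum.cartesian_product[symmetric])
  also have "\<dots> = (\<Sum>\<rho>\<in>permutations_of_set ({..<n} - {s}). \<Sum>\<pi>\<in>?P. of_int (sign \<pi>) * word A \<pi> \<rho>)"
    by (rule sum.reindex_bij_betw[OF bij_betw_orderings[OF s]])
  finally show ?thesis .
qed

text \<open>Summing over the intermediate column \<open>r\<close> removes the constraint
  \<open>\<pi> s = r\<close>, so \<pi> runs over all permutations. Commutator, degree and weight
  arguments all start from this form.\<close>

lemma mult_preadjoint_index:
  fixes A :: "'a::ring_1 mat"
  assumes A: "A \<in> carrier_mat n n" and t: "t < n" and s: "s < n"
  shows "(A * preadjoint A) $$ (t, s) = (\<Sum>\<rho>\<in>permutations_of_set ({..<n} - {s}).
    \<Sum>\<pi> | \<pi> permutes {..<n}. of_int (sign \<pi>) * (A $$ (t, \<pi> s) * word A \<pi> \<rho>))"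
proof -
  let ?R = "permutations_of_set ({..<n} - {s})"
  let ?P = "{\<pi>. \<pi> permutes {..<n}}"
  let ?g = "\<lambda>\<rho> \<pi>. of_int (sign \<pi>) * (A $$ (t, \<pi> s) * word A \<pi> \<rho>)"
  have pull: "x * (of_int m * y) = of_int m * (x * y)" for x y :: 'a and m
    by (metis mult.assoc mult_of_int_commute)
  have Pi: "(\<lambda>\<pi>. \<pi> s) ` ?P \<subseteq> {..<n}"
    using s by (auto dest: permutes_in_image[of _ "{..<n}" s])
  have "(A * preadjoint A) $$ (t, s) = (\<Sum>r<n. A $$ (t, r) * preadjoint A $$ (r, s))"
    using t s carrier_matD[OF A] carrier_matD[OF preadjoint_carrier[OF A]]
    by (simp add: scalar_prod_def atLeast0LessThan)
  also have "\<dots> = (\<Sum>r<n. \<Sum>\<rho>\<in>?R. \<Sum>\<pi> | \<pi> permutes {..<n} \<and> \<pi> s = r. ?g \<rho> \<pi>)"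
    using A s by (intro sum.cong refl)
      (auto simp: preadjoint_index sum_distrib_left pull intro!: sum.cong)
  also have "\<dots> = (\<Sum>\<rho>\<in>?R. \<Sum>r<n. \<Sum>\<pi> | \<pi> permutes {..<n} \<and> \<pi> s = r. ?g \<rho> \<pi>)"
    by (rule sum.swap)
  also have "\<dots> = (\<Sum>\<rho>\<in>?R. \<Sum>\<pi>\<in>?P. ?g \<rho> \<pi>)"
  proof (rule sum.cong[OF refl])
    fix \<rho>
    show "(\<Sum>r<n. \<Sum>\<pi> | \<pi> permutes {..<n} \<and> \<pi> s = r. ?g \<rho> \<pi>) = (\<Sum>\<pi>\<in>?P. ?g \<rho> \<pi>)"
      using sum.group[OF finite_permutations[of "{..<n}"] finite_lessThan Pi, of "?g \<rho>"]
      by (simp only: mem_Collect_eq finite_lessThan simp_thms)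
  qed
  finally show ?thesis .
qed

section \<open>Cyclic rotation of orderings\<close>

text \<open>The ordering \<open>u @ t # v\<close> becomes \<open>v @ s # u\<close>. With the omitted
  row put in front, this rotates \<open>s # u @ t # v\<close> to \<open>t # v @ s # u\<close>. For
  \<open>s = t\<close> it exchanges the parts before and after \<open>t\<close>.\<close>

definition swap_at :: "nat \<Rightarrow> nat \<Rightarrow> nat list \<Rightarrow> nat list" where
  "swap_at t s \<rho> = tl (dropWhile (\<lambda>i. i \<noteq> t) \<rho>) @ s # takeWhile (\<lambda>i. i \<noteq> t) \<rho>"

lemma swap_at_append: "t \<notin> set u \<Longrightarrow> swap_at t s (u @ t # v) = v @ s # u"
proof -
  assume "t \<notin> set u"
  then have "takeWhile (\<lambda>i. i \<noteq> t) (u @ t # v) = u" "dropWhile (\<lambda>i. i \<noteq> t) (u @ t # v) = t # v"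
    by (subst takeWhile_append2 dropWhile_append2; auto)+
  then show ?thesis by (simp add: swap_at_def)
qed

lemma permutations_of_set_splitE:
  assumes "\<rho> \<in> permutations_of_set X" and "t \<in> X"
  obtains u v where "\<rho> = u @ t # v" "set u \<union> set v = X - {t}" "distinct (u @ v)"
    "t \<notin> set u" "t \<notin> set v" "swap_at t s \<rho> = v @ s # u"
proof -
  from assms have "t \<in> set \<rho>" "set \<rho> = X" "distinct \<rho>" by (auto dest: permutations_of_setD)
  then obtain u v where uv: "\<rho> = u @ t # v" by (meson split_list)
  show thesis
    using \<open>set \<rho> = X\<close> \<open>distinct \<rho>\<close> uv by (intro that[OF uv]) (auto simp: swap_at_append)
qed

lemma swap_at_swap_at:
  assumes "\<rho> \<in> permutations_of_set X" "t \<in> X" "s \<notin> X - {t}"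
  shows "swap_at s t (swap_at t s \<rho>) = \<rho>"
    and "swap_at t s \<rho> \<in> permutations_of_set (insert s (X - {t}))"
proof -
  obtain u v where uv: "\<rho> = u @ t # v" "set u \<union> set v = X - {t}" "distinct (u @ v)"
    "t \<notin> set u" "t \<notin> set v" "swap_at t s \<rho> = v @ s # u"
    by (rule permutations_of_set_splitE[OF assms(1,2)])
  have s: "s \<notin> set u" "s \<notin> set v" using uv(2) assms(3) by blast+
  show "swap_at s t (swap_at t s \<rho>) = \<rho>"
    by (simp only: uv(6) swap_at_append[OF s(2)]) (rule uv(1)[symmetric])
  show "swap_at t s \<rho> \<in> permutations_of_set (insert s (X - {t}))"
    unfolding uv(6) uv(2)[symmetric] using uv(3) s by (intro permutations_of_setI) auto
qed

text \<open>The inverse exchanges the roles of \<open>s\<close> and \<open>t\<close>. The condition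
  on \<open>s\<close> admits both \<open>s = t\<close>, used off the diagonal, and \<open>s\<close>
  outside \<open>X\<close>, used on the diagonal.\<close>

lemma bij_betw_swap_at:
  assumes t: "t \<in> X" and s: "s \<notin> X - {t}"
  shows "bij_betw (swap_at t s) (permutations_of_set X) (permutations_of_set (insert s (X - {t})))"
proof (rule bij_betw_byWitness[where f' = "swap_at s t"])
  let ?Y = "insert s (X - {t})"
  have Y: "s \<in> ?Y" "t \<notin> ?Y - {s}" and X: "insert t (?Y - {s}) = X" using t s by blast+
  show "\<forall>\<rho>\<in>permutations_of_set X. swap_at s t (swap_at t s \<rho>) = \<rho>"
    "swap_at t s ` permutations_of_set X \<subseteq> permutations_of_set ?Y"
    using swap_at_swap_at[OF _ t s] by blast+
  show "\<forall>\<rho>\<in>permutations_of_set ?Y. swap_at t s (swap_at s t \<rho>) = \<rho>"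
    "swap_at s t ` permutations_of_set ?Y \<subseteq> permutations_of_set X"
    using swap_at_swap_at[OF _ Y] unfolding X by blast+
qed

section \<open>The product of a matrix with its preadjoint modulo commutators\<close>

definition entries :: "nat \<Rightarrow> 'a mat \<Rightarrow> 'a set" where
  "entries n A = {A $$ (i, j) |i j. i < n \<and> j < n}"

definition scalar_mod :: "nat \<Rightarrow> 'a::ring_1 set \<Rightarrow> 'a mat \<Rightarrow> bool" where
  "scalar_mod n G B \<longleftrightarrow> (\<forall>i<n. \<forall>j<n. B $$ (i, j) - (if i = j then B $$ (0, 0) else 0) \<in> G)"

lemma scalar_mod_mono: "scalar_mod n G B \<Longrightarrow> G \<subseteq> G' \<Longrightarrow> scalar_mod n G' B"
  unfolding scalar_mod_def by blast

text \<open>Since \<open>G\<close> is only an additive group, the assumption concerns commutators of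
  products of entries and not just of entries. It is instantiated with \<open>lcs 1\<close>, where
  it holds for every matrix, and then with terms of the filtration.\<close>

context
  fixes n :: nat and A :: "'a::ring_1 mat" and G :: "'a set"
  assumes A: "A \<in> carrier_mat n n" and G: "add_subgroup G"
    and comm: "\<And>xs ys. set xs \<subseteq> entries n A \<Longrightarrow> set ys \<subseteq> entries n A \<Longrightarrow>
      commutator (prod_list xs) (prod_list ys) \<in> G"
begin

lemma commutator_words_mem:
  assumes "i < n" "j < n" "i' < n" "j' < n" "\<pi> permutes {..<n}" "set u \<subseteq> {..<n}" "set v \<subseteq> {..<n}"
  shows "commutator (A $$ (i, j) * word A \<pi> u) (A $$ (i', j') * word A \<pi> v) \<in> G"
proof -
  have mem: "set (map (\<lambda>i. A $$ (i, \<pi> i)) u) \<subseteq> entries n A" if "set u \<subseteq> {..<n}" for u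
    using that permutes_in_image[OF assms(5)] unfolding entries_def by auto
  show ?thesis
    using comm[of "A $$ (i, j) # map (\<lambda>i. A $$ (i, \<pi> i)) u"
        "A $$ (i', j') # map (\<lambda>i. A $$ (i, \<pi> i)) v"] assms mem
    by (auto simp: word_def entries_def)
qed

text \<open>Composing \<open>\<pi>\<close> with the transposition of \<open>s\<close> and \<open>t\<close> changes the sign and exchanges the two
  factors from row \<open>t\<close>; rotating the ordering of the remaining factors accordingly turns the two
  words into \<open>p q\<close> and \<open>q p\<close>.\<close>
lemma mult_preadjoint_off_diag:
  assumes t: "t < n" and s: "s < n" and ts: "t \<noteq> s"
  shows "(A * preadjoint A) $$ (t, s) \<in> G"
proof -
  let ?X = "{..<n} - {s}"
  let ?R = "permutations_of_set ?X"
  let ?P = "{\<pi>. \<pi> permutes {..<n}}"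
  \<comment> \<open>Picks one permutation from each pair \<open>\<pi>\<close>,
    \<open>\<pi> \<circ> ?\<sigma>\<close>.\<close>
  let ?H = "{\<pi>. \<pi> permutes {..<n} \<and> \<pi> s < \<pi> t}"
  let ?H' = "{\<pi>. \<pi> permutes {..<n} \<and> \<pi> t < \<pi> s}"
  let ?\<sigma> = "transpose s t"
  let ?g = "\<lambda>\<pi> \<rho>. of_int (sign \<pi>) * (A $$ (t, \<pi> s) * word A \<pi> \<rho>)"
  have fin: "finite ?P" by (simp add: finite_permutations)
  have \<sigma>: "?\<sigma> permutes {..<n}" using s t by (simp add: permutes_swap_id)
  have P: "?P = ?H \<union> ?H'"
  proof (rule Set.set_eqI)
    fix \<pi>
    have "\<pi> s < \<pi> t \<or> \<pi> t < \<pi> s" if "\<pi> permutes {..<n}"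
      using ts injD[OF permutes_inj[OF that], of s t] by linarith
    then show "\<pi> \<in> ?P \<longleftrightarrow> \<pi> \<in> ?H \<union> ?H'" unfolding Un_iff mem_Collect_eq by argo
  qed
  have finH: "finite ?H" "finite ?H'" by (auto intro: finite_subset[OF _ fin])
  have bij: "bij_betw (\<lambda>\<pi>. \<pi> \<circ> ?\<sigma>) ?H ?H'"
    by (rule bij_betw_byWitness[where f' = "\<lambda>\<pi>. \<pi> \<circ> ?\<sigma>"])
      (auto simp: comp_assoc intro: permutes_compose[OF \<sigma>])
  have "(A * preadjoint A) $$ (t, s) = (\<Sum>\<pi>\<in>?P. \<Sum>\<rho>\<in>?R. ?g \<pi> \<rho>)"
    unfolding mult_preadjoint_index[OF A t s] by (rule sum.swap)
  also have "\<dots> = (\<Sum>\<pi>\<in>?H. \<Sum>\<rho>\<in>?R. ?g \<pi> \<rho>) + (\<Sum>\<pi>\<in>?H'. \<Sum>\<rho>\<in>?R. ?g \<pi> \<rho>)"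
    unfolding P using finH by (intro sum.union_disjoint) auto
  also have "(\<Sum>\<pi>\<in>?H'. \<Sum>\<rho>\<in>?R. ?g \<pi> \<rho>) = (\<Sum>\<pi>\<in>?H. \<Sum>\<rho>\<in>?R. ?g (\<pi> \<circ> ?\<sigma>) \<rho>)"
    by (rule sum.reindex_bij_betw[OF bij, symmetric])
  also have "(\<Sum>\<pi>\<in>?H. \<Sum>\<rho>\<in>?R. ?g \<pi> \<rho>) + \<dots> =
      (\<Sum>\<pi>\<in>?H. (\<Sum>\<rho>\<in>?R. ?g \<pi> \<rho>) + (\<Sum>\<rho>\<in>?R. ?g (\<pi> \<circ> ?\<sigma>) \<rho>))"
    by (rule sum.distrib[symmetric])
  also have "\<dots> \<in> G"
  proof (rule add_subgroup_sum[OF G])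
    fix \<pi> assume "\<pi> \<in> ?H"
    then have \<pi>: "\<pi> permutes {..<n}" by simp
    have tX: "t \<in> ?X" "t \<notin> ?X - {t}" "insert t (?X - {t}) = ?X" using t ts by auto
    \<comment> \<open>Reindexing only the sum for \<open>\<pi> \<circ> ?\<sigma>\<close> by this
      rotation pairs the two words termwise.\<close>
    have bijR: "bij_betw (swap_at t t) ?R ?R"
      using bij_betw_swap_at[OF tX(1,2)] tX(3) by simp
    have sg: "sign (\<pi> \<circ> ?\<sigma>) = - sign \<pi>"
      using sign_compose[OF permutes_imp_permutation[OF _ \<pi>] permutes_imp_permutation[OF _ \<sigma>]] ts
      by (simp add: sign_swap_id)
    have "(\<Sum>\<rho>\<in>?R. ?g \<pi> \<rho>) + (\<Sum>\<rho>\<in>?R. ?g (\<pi> \<circ> ?\<sigma>) \<rho>) =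
        (\<Sum>\<rho>\<in>?R. ?g \<pi> \<rho> + ?g (\<pi> \<circ> ?\<sigma>) (swap_at t t \<rho>))"
      using sum.reindex_bij_betw[OF bijR, of "?g (\<pi> \<circ> ?\<sigma>)"] by (simp add: sum.distrib)
    also have "\<dots> \<in> G"
    proof (rule add_subgroup_sum[OF G])
      fix \<rho> assume \<rho>: "\<rho> \<in> ?R"
      obtain u v where uv: "\<rho> = u @ t # v" "set u \<union> set v = ?X - {t}" "distinct (u @ v)"
        "t \<notin> set u" "t \<notin> set v" "swap_at t t \<rho> = v @ t # u"
        by (rule permutations_of_set_splitE[OF \<rho> tX(1)])
      have "i \<noteq> s \<and> i \<noteq> t" if "i \<in> set u \<union> set v" for i
        using that unfolding uv(2) by simp
      then have w: "word A (\<pi> \<circ> ?\<sigma>) u = word A \<pi> u" "word A (\<pi> \<circ> ?\<sigma>) v = word A \<pi> v"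
        by (auto intro!: word_cong simp: transpose_def)
      have uv_sub: "set u \<subseteq> {..<n}" "set v \<subseteq> {..<n}" using uv(2) by blast+
      have "?g \<pi> \<rho> + ?g (\<pi> \<circ> ?\<sigma>) (swap_at t t \<rho>) = of_int (sign \<pi>) *
          commutator (A $$ (t, \<pi> s) * word A \<pi> u) (A $$ (t, \<pi> t) * word A \<pi> v)"
        unfolding uv(6) by (simp add: uv(1) w sg commutator_def algebra_simps)
      also have "\<dots> \<in> G"
        using permutes_in_image[OF \<pi>, of s] permutes_in_image[OF \<pi>, of t] s t
        by (intro add_subgroup_of_int_mult[OF G] commutator_words_mem \<pi> uv_sub) simp_all
      finally show "?g \<pi> \<rho> + ?g (\<pi> \<circ> ?\<sigma>) (swap_at t t \<rho>) \<in> G" .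
    qed
    finally show "(\<Sum>\<rho>\<in>?R. ?g \<pi> \<rho>) + (\<Sum>\<rho>\<in>?R. ?g (\<pi> \<circ> ?\<sigma>) \<rho>) \<in> G" .
  qed
  finally show ?thesis .
qed

text \<open>For a fixed \<pi> the words at \<open>(s, s)\<close> and \<open>(t, t)\<close> are the
  same cyclic product over all rows, begun at row \<open>s\<close> and at row \<open>t\<close>. They
  have the form \<open>p q\<close> and \<open>q p\<close> with equal sign, so they differ by a
  commutator.\<close>

lemma mult_preadjoint_diag:
  assumes t: "t < n" and s: "s < n"
  shows "(A * preadjoint A) $$ (s, s) - (A * preadjoint A) $$ (t, t) \<in> G"
proof (cases "t = s")
  case True
  then show ?thesis using add_subgroup_zero[OF G] by simp
next
  case False
  let ?X = "{..<n} - {s}"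
  let ?P = "{\<pi>. \<pi> permutes {..<n}}"
  let ?g = "\<lambda>s \<rho>. \<Sum>\<pi>\<in>?P. of_int (sign \<pi>) * (A $$ (s, \<pi> s) * word A \<pi> \<rho>)"
  have tX: "t \<in> ?X" "s \<notin> ?X - {t}" "insert s (?X - {t}) = {..<n} - {t}" using s t False by auto
  have bij: "bij_betw (swap_at t s) (permutations_of_set ?X) (permutations_of_set ({..<n} - {t}))"
    using bij_betw_swap_at[OF tX(1,2)] unfolding tX(3) .
  have "(A * preadjoint A) $$ (s, s) - (A * preadjoint A) $$ (t, t) =
      (\<Sum>\<rho>\<in>permutations_of_set ?X. ?g s \<rho> - ?g t (swap_at t s \<rho>))"
    using sum.reindex_bij_betw[OF bij, of "?g t"]
    by (simp add: mult_preadjoint_index[OF A t t] mult_preadjoint_index[OF A s s] sum_subtractf)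
  also have "\<dots> \<in> G"
  proof (rule add_subgroup_sum[OF G])
    fix \<rho> assume \<rho>: "\<rho> \<in> permutations_of_set ?X"
    obtain u v where uv: "\<rho> = u @ t # v" "set u \<union> set v = ?X - {t}" "distinct (u @ v)"
      "t \<notin> set u" "t \<notin> set v" "swap_at t s \<rho> = v @ s # u"
      by (rule permutations_of_set_splitE[OF \<rho> tX(1)])
    have uv_sub: "set u \<subseteq> {..<n}" "set v \<subseteq> {..<n}" using uv(2) by blast+
    have "?g s \<rho> - ?g t (swap_at t s \<rho>) = (\<Sum>\<pi>\<in>?P. of_int (sign \<pi>) *
        commutator (A $$ (s, \<pi> s) * word A \<pi> u) (A $$ (t, \<pi> t) * word A \<pi> v))"
      unfolding uv(6) by (simp add: uv(1) commutator_def algebra_simps sum_subtractf)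
    also have "\<dots> \<in> G"
    proof (intro add_subgroup_sum[OF G] add_subgroup_of_int_mult[OF G])
      fix \<pi> assume "\<pi> \<in> ?P"
      then have \<pi>: "\<pi> permutes {..<n}" by simp
      show "commutator (A $$ (s, \<pi> s) * word A \<pi> u) (A $$ (t, \<pi> t) * word A \<pi> v) \<in> G"
        using permutes_in_image[OF \<pi>, of s] permutes_in_image[OF \<pi>, of t] s t
        by (intro commutator_words_mem \<pi> uv_sub) simp_all
    qed
    finally show "?g s \<rho> - ?g t (swap_at t s \<rho>) \<in> G" .
  qed
  finally show ?thesis .
qed

lemma scalar_mod_mult_preadjoint: "scalar_mod n G (A * preadjoint A)"
  unfolding scalar_mod_def
proof (intro allI impI)
  fix i j assume "i < n" "j < n"
  then show "(A * preadjoint A) $$ (i, j) -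
      (if i = j then (A * preadjoint A) $$ (0, 0) else 0) \<in> G"
    using mult_preadjoint_off_diag[of i j] mult_preadjoint_diag[of 0 i] by auto
qed

end

section \<open>The right adjoint sequence over a Lie nilpotent ring\<close>

text \<open>The Leibniz rule in each argument. The remaining factors are products of elements of the
  subring, and the filtration is closed under multiplication by these on both sides.\<close>

lemma commutator_prod_list_mem:
  assumes E: "E \<subseteq> comm_subring c"
    and comm: "\<And>x y. x \<in> E \<Longrightarrow> y \<in> E \<Longrightarrow> commutator x y \<in> comm_filt c j"
    and "set xs \<subseteq> E" "set ys \<subseteq> E"
  shows "commutator (prod_list xs) (prod_list ys) \<in> comm_filt c j"
proof -
  note J = add_subgroup_comm_filt[of c j]
  have prod: "prod_list zs \<in> comm_subring c" if "set zs \<subseteq> E" for zs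
    using that E by (induction zs) (auto intro: comm_subring.one comm_subring.mult)
  have one: "commutator x 1 = 0" "commutator 1 x = 0" for x :: 'a
    by (simp_all add: commutator_def)
  have right: "commutator x (prod_list ys) \<in> comm_filt c j" if "x \<in> E" for x
    using assms(4)
  proof (induction ys)
    case Nil
    then show ?case by (simp add: one add_subgroup_zero[OF J])
  next
    case (Cons y ys)
    have "commutator x y * prod_list ys + y * commutator x (prod_list ys) \<in> comm_filt c j"
      using that Cons E
      by (intro add_subgroup_add[OF J comm_filt_mult_right comm_filt_mult_left])
        (simp_all add: comm prod subset_iff)
    then show ?case by (simp add: commutator_mult_right)
  qed
  show ?thesis
    using assms(3)
  proof (induction xs)
    case Nil
    then show ?case by (simp add: one add_subgroup_zero[OF J])
  next
    case (Cons x xs)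
    have "x * commutator (prod_list xs) (prod_list ys) + commutator x (prod_list ys) * prod_list xs
        \<in> comm_filt c j"
      using Cons E
      by (intro add_subgroup_add[OF J comm_filt_mult_left comm_filt_mult_right])
        (simp_all add: right prod subset_iff)
    then show ?case by (simp add: commutator_mult_left)
  qed
qed

lemma scalar_modE:
  assumes "scalar_mod n G B" and "x \<in> entries n B"
  obtains e where "e \<in> {B $$ (0, 0), 0}" and "x - e \<in> G"
proof -
  from assms(2) obtain i j where ij: "x = B $$ (i, j)" "i < n" "j < n" by (auto simp: entries_def)
  show thesis
    using that[of "if i = j then B $$ (0, 0) else 0"] assms(1) ij by (auto simp: scalar_mod_def)
qed

lemma entries_mult_preadjoint:
  assumes A: "A \<in> carrier_mat n n" and E: "entries n A \<subseteq> comm_subring c"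
  shows "entries n (A * preadjoint A) \<subseteq> comm_subring c"
proof
  note S = add_subgroup_comm_subring[of c]
  have entry: "A $$ (i, j) \<in> comm_subring c" if "i < n" "j < n" for i j
    using that E by (auto simp: entries_def)
  have word: "word A \<pi> \<rho> \<in> comm_subring c" if "\<pi> permutes {..<n}" "set \<rho> \<subseteq> {..<n}" for \<pi> \<rho>
    using that(2) permutes_in_image[OF that(1)]
    by (induction \<rho>) (auto intro!: comm_subring.one comm_subring.mult entry)
  fix x assume "x \<in> entries n (A * preadjoint A)"
  then obtain t s where x: "x = (A * preadjoint A) $$ (t, s)" and ts: "t < n" "s < n"
    by (auto simp: entries_def)
  show "x \<in> comm_subring c"
    unfolding x mult_preadjoint_index[OF A ts]
  proof (intro add_subgroup_sum[OF S] add_subgroup_of_int_mult[OF S] comm_subring.mult)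
    fix \<rho> \<pi> assume \<rho>: "\<rho> \<in> permutations_of_set ({..<n} - {s})" and \<pi>: "\<pi> \<in> {\<pi>. \<pi> permutes {..<n}}"
    show "A $$ (t, \<pi> s) \<in> comm_subring c"
      using \<pi> ts permutes_in_image[of \<pi> "{..<n}" s] by (auto intro: entry)
    show "word A \<pi> \<rho> \<in> comm_subring c"
      using \<pi> permutations_of_setD(1)[OF \<rho>] by (intro word) auto
  qed
qed

text \<open>Any two entries are congruent to \<open>d\<close> and \<open>e\<close>, each 0 or the
  same diagonal entry, so \<open>d\<close> and \<open>e\<close> commute. The commutator of the
  entries is therefore made of brackets of \<open>S\<close> with the filtration, which go one step
  deeper.\<close>

lemma scalar_mod_step:
  assumes A: "A \<in> carrier_mat n n" and n: "0 < n" and E: "entries n A \<subseteq> comm_subring c"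
    and scalar: "scalar_mod n (comm_filt c (Suc j)) A"
  shows "scalar_mod n (comm_filt c (Suc (Suc j))) (A * preadjoint A)"
proof (rule scalar_mod_mult_preadjoint[OF A add_subgroup_comm_filt commutator_prod_list_mem[OF E]])
  let ?J = "comm_filt c (Suc (Suc j))"
  note J = add_subgroup_comm_filt[of c "Suc (Suc j)"]
  have S0: "0 \<in> comm_subring c" by (rule add_subgroup_zero[OF add_subgroup_comm_subring])
  have S00: "A $$ (0, 0) \<in> comm_subring c" using E n by (auto simp: entries_def)
  fix x y assume x: "x \<in> entries n A" and y: "y \<in> entries n A"
  obtain d where d: "d \<in> {A $$ (0, 0), 0}" "x - d \<in> comm_filt c (Suc j)"
    by (rule scalar_modE[OF scalar x])
  obtain e where e: "e \<in> {A $$ (0, 0), 0}" "y - e \<in> comm_filt c (Suc j)"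
    by (rule scalar_modE[OF scalar y])
  have "commutator d e = 0" using d(1) e(1) by (auto simp: commutator_def)
  then have "commutator x y = commutator x (y - e) - commutator e (x - d)"
    by (simp add: commutator_def algebra_simps)
  also have "\<dots> \<in> ?J"
    using x E e S0 S00 by (intro add_subgroup_diff[OF J] commutator_comm_filt d(2) e(2)) auto
  finally show "commutator x y \<in> ?J" .
qed

text \<open>The first product is special: it is scalar modulo \<open>lcs 1\<close>, and this is what
  puts its entries into the subring generated by its own corner entry \<open>c\<close> and the
  commutators. From then on \<open>c\<close> stays fixed and each further factor raises the
  filtration index by one.\<close>

lemma right_adjoint_prod_scalar_mod:
  fixes A :: "'a::ring_1 mat"
  assumes A: "A \<in> carrier_mat n n" and n: "0 < n"
    and c: "c = right_adjoint_prod A (Suc 0) $$ (0, 0)"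
  shows "entries n (right_adjoint_prod A (Suc m)) \<subseteq> comm_subring c \<and>
    scalar_mod n (comm_filt c (Suc m)) (right_adjoint_prod A (Suc m))"
proof (induction m)
  case 0
  let ?B = "right_adjoint_prod A (Suc 0)"
  have "scalar_mod n (lcs 1) (A * preadjoint A)"
    by (rule scalar_mod_mult_preadjoint[OF A add_subgroup_lcs]) (simp add: commutator_lcs)
  then have sc: "scalar_mod n (lcs 1) ?B" by simp
  have "entries n ?B \<subseteq> comm_subring c"
  proof
    note S = add_subgroup_comm_subring[of c]
    fix x assume "x \<in> entries n ?B"
    then obtain e where e: "e \<in> {?B $$ (0, 0), 0}" "x - e \<in> lcs 1"
      by (rule scalar_modE[OF sc])
    have "e \<in> comm_subring c"
      using e(1) c comm_subring.gen[of c] add_subgroup_zero[OF S] by auto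
    then show "x \<in> comm_subring c"
      using add_subgroup_add[OF S, of "x - e" e] lcs_1_subset e(2) by auto
  qed
  moreover have "scalar_mod n (comm_filt c (Suc 0)) ?B"
    using scalar_mod_mono[OF sc lcs_subset_comm_filt] by simp
  ultimately show ?case by blast
next
  case (Suc m)
  let ?B = "right_adjoint_prod A (Suc m)"
  have B: "?B \<in> carrier_mat n n" by (rule right_adjoint_prod_carrier[OF A])
  have "right_adjoint_prod A (Suc (Suc m)) = ?B * preadjoint ?B" by simp
  with Suc show ?case
    using entries_mult_preadjoint[OF B] scalar_mod_step[OF B n] by metis
qed

text \<open>The filtration term of index \<open>k\<close> vanishes, so the congruence becomes an
  equality. Positivity of \<open>k\<close> enters because the congruences begin with
  \<open>A P\<^sub>1\<close>.\<close>

lemma right_adjoint_prod_scalar: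
  fixes A :: "'a::ring_1 mat"
  assumes A: "A \<in> carrier_mat n n" and k: "0 < k" and nil: "lcs k = {0::'a}"
    and ij: "i < n" "j < n"
  shows "right_adjoint_prod A k $$ (i, j) = (if i = j then right_adjoint_prod A k $$ (0, 0) else 0)"
proof -
  obtain m where m: "k = Suc m" using k by (cases k) auto
  have "0 < n" using ij by simp
  from right_adjoint_prod_scalar_mod[OF A this refl, of m]
  have "scalar_mod n {0} (right_adjoint_prod A k)"
    unfolding m[symmetric] comm_filt_eq_zero[OF nil] by (rule conjunct2)
  then have "right_adjoint_prod A k $$ (i, j) -
      (if i = j then right_adjoint_prod A k $$ (0, 0) else 0) \<in> {0}"
    using ij unfolding scalar_mod_def by blast
  then show ?thesis by (simp only: singleton_iff right_minus_eq)
qed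

lemma rdet_eq:
  fixes A :: "'a::ring_1 mat"
  assumes A: "A \<in> carrier_mat n n" and "0 < k" and "lcs k = {0::'a}"
  shows "rdet k A = of_nat n * right_adjoint_prod A k $$ (0, 0)"
proof -
  let ?B = "right_adjoint_prod A k"
  have "dim_row ?B = n"
    using right_adjoint_prod_carrier[OF A] by (rule carrier_matD)
  then have "rdet k A = (\<Sum>i<n. ?B $$ (i, i))"
    by (simp add: rdet_def mat_trace_def)
  also have "\<dots> = (\<Sum>i<n. ?B $$ (0, 0))"
    using right_adjoint_prod_scalar[OF assms] by (intro sum.cong refl) (metis lessThan_iff)
  finally show ?thesis by simp
qed

text \<open>Here \<open>Q\<close> is the product \<open>P\<^sub>1 \<cdots> P\<^sub>k\<close>. Only
  the position of \<open>A\<close> as left factor is used afterwards.\<close>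

lemma right_adjoint_prod_factor:
  assumes A: "A \<in> carrier_mat n n"
  obtains Q where "Q \<in> carrier_mat n n" and "right_adjoint_prod A k = A * Q"
proof -
  have "\<exists>Q \<in> carrier_mat n n. right_adjoint_prod A k = A * Q"
  proof (induction k)
    case 0
    show ?case using A by (intro bexI[of _ "1\<^sub>m n"]) auto
  next
    case (Suc k)
    then obtain Q where Q: "Q \<in> carrier_mat n n" "right_adjoint_prod A k = A * Q" by blast
    have P: "right_adjoint A k \<in> carrier_mat n n" using A by simp
    show ?case
      using Q(2) assoc_mult_mat[OF A Q(1) P] mult_carrier_mat[OF Q(1) P]
      by (intro bexI[of _ "Q * right_adjoint A k"]) (simp_all del: right_adjoint.simps)
  qed
  with that show thesis by blast
qed

section \<open>Polynomial coefficients and degrees\<close>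

lemma lookup_times:
  fixes p q :: "nat \<Rightarrow>\<^sub>0 'a::semiring_0"
  shows "Poly_Mapping.lookup (p * q) i =
    (\<Sum>j\<le>i. Poly_Mapping.lookup p j * Poly_Mapping.lookup q (i - j))"
proof -
  have inner: "(\<Sum>m. Poly_Mapping.lookup q m when i = j + m) =
      (if j \<le> i then Poly_Mapping.lookup q (i - j) else 0)" for j
  proof (cases "j \<le> i")
    case True
    then have eq: "(\<lambda>m. Poly_Mapping.lookup q m when i = j + m) =
        (\<lambda>m. if m = i - j then Poly_Mapping.lookup q m else 0)"
      by (auto simp: when_def fun_eq_iff)
    show ?thesis unfolding eq using True by simp
  next
    case False
    then have "(\<lambda>m. Poly_Mapping.lookup q m when i = j + m) = (\<lambda>m. 0)"
      by (auto simp: when_def fun_eq_iff)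
    with False show ?thesis by simp
  qed
  have "Poly_Mapping.lookup (p * q) i =
      (\<Sum>j. Poly_Mapping.lookup p j * (if j \<le> i then Poly_Mapping.lookup q (i - j) else 0))"
    by (simp add: lookup_mult inner)
  also have "\<dots> = (\<Sum>j\<le>i. Poly_Mapping.lookup p j *
      (if j \<le> i then Poly_Mapping.lookup q (i - j) else 0))"
    by (rule Sum_any.expand_superset) (auto split: if_splits)
  finally show ?thesis by simp
qed

lemma lookup_const_mult:
  fixes q :: "nat \<Rightarrow>\<^sub>0 'a::semiring_0"
  shows "Poly_Mapping.lookup (Poly_Mapping.single 0 a * q) i = a * Poly_Mapping.lookup q i"
proof -
  have "Poly_Mapping.lookup (Poly_Mapping.single 0 a * q) i =
      (\<Sum>j\<le>i. if j = 0 then a * Poly_Mapping.lookup q i else 0)"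
    unfolding lookup_times by (intro sum.cong) (auto simp: lookup_single when_def)
  then show ?thesis by simp
qed

lemma lookup_mult_const:
  fixes q :: "nat \<Rightarrow>\<^sub>0 'a::semiring_0"
  shows "Poly_Mapping.lookup (q * Poly_Mapping.single 0 a) i = Poly_Mapping.lookup q i * a"
proof -
  have "Poly_Mapping.lookup (q * Poly_Mapping.single 0 a) i =
      (\<Sum>j\<le>i. if j = i then Poly_Mapping.lookup q i * a else 0)"
    unfolding lookup_times by (intro sum.cong) (auto simp: lookup_single when_def)
  then show ?thesis by simp
qed

lemma lookup_var_mult:
  fixes q :: "nat \<Rightarrow>\<^sub>0 'a::semiring_1"
  shows "Poly_Mapping.lookup (Poly_Mapping.single 1 1 * q) i =
    (if i = 0 then 0 else Poly_Mapping.lookup q (i - 1))"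
proof -
  have "Poly_Mapping.lookup (Poly_Mapping.single 1 1 * q) i =
      (\<Sum>j\<le>i. if j = 1 then Poly_Mapping.lookup q (i - 1) else 0)"
    unfolding lookup_times by (intro sum.cong) (auto simp: lookup_single when_def)
  then show ?thesis by auto
qed

lemma lookup_of_int_mult:
  fixes p :: "nat \<Rightarrow>\<^sub>0 'a::ring_1"
  shows "Poly_Mapping.lookup (of_int m * p) i = of_int m * Poly_Mapping.lookup p i"
  using lookup_const_mult[of "of_int m" p i] by simp

lemma lookup_of_nat_mult:
  fixes p :: "nat \<Rightarrow>\<^sub>0 'a::ring_1"
  shows "Poly_Mapping.lookup (of_nat m * p) i = of_nat m * Poly_Mapping.lookup p i"
  using lookup_const_mult[of "of_nat m" p i] by simp

section \<open>Lie nilpotency of the polynomial ring\<close>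

text \<open>The indeterminate is central, so each coefficient of \<open>[p, q]\<close> is a sum of
  commutators of a coefficient of \<open>p\<close> with one of \<open>q\<close>.\<close>

lemma lookup_lcs:
  fixes p :: "nat \<Rightarrow>\<^sub>0 'a::ring_1"
  assumes "p \<in> lcs j"
  shows "Poly_Mapping.lookup p i \<in> lcs j"
  using assms
proof (induction j arbitrary: p i)
  case (Suc j)
  show ?case
  proof (rule add_span_map_induct[where f = "\<lambda>p. Poly_Mapping.lookup p i"])
    show "p \<in> add_span {commutator x y |x y. x \<in> lcs j}" using Suc.prems by (simp only: lcs.simps)
  next
    fix x :: "nat \<Rightarrow>\<^sub>0 'a"
    assume "x \<in> {commutator x y |x y. x \<in> lcs j}"
    then obtain p q where x: "x = commutator p q" and p: "p \<in> lcs j" by blast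
    \<comment> \<open>Reversing the convolution for \<open>q p\<close> aligns it termwise with the
      one for \<open>p q\<close>.\<close>
    have "(\<Sum>l\<le>i. Poly_Mapping.lookup q l * Poly_Mapping.lookup p (i - l)) =
        (\<Sum>l\<le>i. Poly_Mapping.lookup q (i - l) * Poly_Mapping.lookup p l)"
      by (rule sum.reindex_bij_witness[of _ "\<lambda>l. i - l" "\<lambda>l. i - l"]) auto
    then have "Poly_Mapping.lookup x i =
        (\<Sum>l\<le>i. commutator (Poly_Mapping.lookup p l) (Poly_Mapping.lookup q (i - l)))"
      by (simp add: x commutator_def lookup_minus lookup_times sum_subtractf)
    also have "\<dots> \<in> lcs (Suc j)"
      by (intro add_subgroup_sum[OF add_subgroup_lcs] commutator_lcs Suc.IH p)
    finally show "Poly_Mapping.lookup x i \<in> lcs (Suc j)" .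
  qed (simp_all add: add_subgroup_lcs lookup_minus)
qed simp

lemma lcs_poly_eq_zero:
  assumes "lcs k = {0::'a::ring_1}"
  shows "lcs k = {0 :: nat \<Rightarrow>\<^sub>0 'a}"
proof -
  have "p = 0" if "p \<in> lcs k" for p :: "nat \<Rightarrow>\<^sub>0 'a"
    using lookup_lcs[OF that] assms by (intro poly_mapping_eqI) simp
  then show ?thesis using add_subgroup_zero[OF add_subgroup_lcs, of k] by blast
qed

section \<open>Degree bounds and leading coefficients\<close>

definition deg_le :: "nat \<Rightarrow> (nat \<Rightarrow>\<^sub>0 'a::ring_1) \<Rightarrow> bool" where
  "deg_le d p \<longleftrightarrow> (\<forall>i>d. Poly_Mapping.lookup p i = 0)"

lemma add_subgroup_deg_le: "add_subgroup {p. deg_le d p}"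
  by (simp add: add_subgroup_def deg_le_def lookup_minus)

lemma deg_le_mult:
  assumes p: "deg_le d p" and q: "deg_le e q"
  shows "deg_le (d + e) (p * q)"
    and "Poly_Mapping.lookup (p * q) (d + e) = Poly_Mapping.lookup p d * Poly_Mapping.lookup q e"
proof -
  have "Poly_Mapping.lookup p j * Poly_Mapping.lookup q (i - j) =
      (if j = d \<and> i = d + e then Poly_Mapping.lookup p d * Poly_Mapping.lookup q e else 0)"
    if "d + e \<le> i" "j \<le> i" for i j
  proof -
    consider "j < d" | "j = d" | "d < j" by linarith
    then show ?thesis
      using that p q by cases (auto simp: deg_le_def)
  qed
  then have eq: "Poly_Mapping.lookup (p * q) i = (\<Sum>j\<le>i. if j = d \<and> i = d + e
      then Poly_Mapping.lookup p d * Poly_Mapping.lookup q e else 0)" if "d + e \<le> i" for i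
    unfolding lookup_times using that by (intro sum.cong) auto
  show "deg_le (d + e) (p * q)" unfolding deg_le_def by (auto simp: eq)
  show "Poly_Mapping.lookup (p * q) (d + e) = Poly_Mapping.lookup p d * Poly_Mapping.lookup q e"
    by (simp add: eq)
qed

text \<open>Coefficients are read at the degree bound and may be zero. Taken this way they are
  multiplicative even in the presence of zero divisors.\<close>

definition top_coeffs :: "nat \<Rightarrow> (nat \<Rightarrow>\<^sub>0 'a::ring_1) mat \<Rightarrow> 'a mat" where
  "top_coeffs d B = map_mat (\<lambda>p. Poly_Mapping.lookup p d) B"

context
  fixes n d :: nat and B :: "(nat \<Rightarrow>\<^sub>0 'a::ring_1) mat"
  assumes B: "B \<in> carrier_mat n n" and deg: "\<And>i j. i < n \<Longrightarrow> j < n \<Longrightarrow> deg_le d (B $$ (i, j))"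
begin

lemma deg_le_word:
  assumes "\<pi> permutes {..<n}" "set \<rho> \<subseteq> {..<n}"
  shows "deg_le (length \<rho> * d) (word B \<pi> \<rho>) \<and>
    Poly_Mapping.lookup (word B \<pi> \<rho>) (length \<rho> * d) = word (top_coeffs d B) \<pi> \<rho>"
  using assms(2)
proof (induction \<rho>)
  case Nil
  then show ?case by (simp add: deg_le_def lookup_one when_def)
next
  case (Cons i \<rho>)
  then have i: "i < n" "\<pi> i < n" using permutes_in_image[OF assms(1), of i] by auto
  have "top_coeffs d B $$ (i, \<pi> i) = Poly_Mapping.lookup (B $$ (i, \<pi> i)) d"
    using i B by (simp add: top_coeffs_def)
  then show ?case
    using Cons deg_le_mult[OF deg[OF i], of "length \<rho> * d" "word B \<pi> \<rho>"] by simp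
qed

text \<open>Every summand is a product of \<open>n\<close> entries, one from row \<open>t\<close>
  and \<open>n - 1\<close> from the word, so the bound is multiplied by \<open>n\<close> and the top
  coefficients multiply factor by factor.\<close>

lemma deg_le_mult_preadjoint:
  assumes t: "t < n" and s: "s < n"
  shows "deg_le (d * n) ((B * preadjoint B) $$ (t, s))"
    and "Poly_Mapping.lookup ((B * preadjoint B) $$ (t, s)) (d * n) =
      (top_coeffs d B * preadjoint (top_coeffs d B)) $$ (t, s)"
proof -
  let ?R = "permutations_of_set ({..<n} - {s})"
  have summand: "deg_le (d * n) (B $$ (t, \<pi> s) * word B \<pi> \<rho>) \<and>
      Poly_Mapping.lookup (B $$ (t, \<pi> s) * word B \<pi> \<rho>) (d * n) =
        top_coeffs d B $$ (t, \<pi> s) * word (top_coeffs d B) \<pi> \<rho>"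
    if \<rho>: "\<rho> \<in> ?R" and \<pi>: "\<pi> permutes {..<n}" for \<rho> \<pi>
  proof -
    have \<pi>s: "\<pi> s < n" using permutes_in_image[OF \<pi>, of s] s by simp
    have sub: "set \<rho> \<subseteq> {..<n}" using permutations_of_setD(1)[OF \<rho>] by blast
    have "length \<rho> = n - 1"
      using permutations_of_setD[OF \<rho>] distinct_card[of \<rho>] s by simp
    then have "d + length \<rho> * d = d * n" using s by (cases n) auto
    moreover have "top_coeffs d B $$ (t, \<pi> s) = Poly_Mapping.lookup (B $$ (t, \<pi> s)) d"
      using t \<pi>s B by (simp add: top_coeffs_def)
    ultimately show ?thesis
      using deg_le_mult[OF deg[OF t \<pi>s] conjunct1[OF deg_le_word[OF \<pi> sub]]]
        deg_le_word[OF \<pi> sub] by metis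
  qed
  show "deg_le (d * n) ((B * preadjoint B) $$ (t, s))"
    unfolding mult_preadjoint_index[OF B t s]
    using add_subgroup_sum[OF add_subgroup_deg_le, of _ _ "d * n"]
      add_subgroup_of_int_mult[OF add_subgroup_deg_le, of _ "d * n"] summand
    by (simp add: deg_le_def lookup_sum lookup_of_int_mult)
  have top: "top_coeffs d B \<in> carrier_mat n n" using B by (simp add: top_coeffs_def)
  show "Poly_Mapping.lookup ((B * preadjoint B) $$ (t, s)) (d * n) =
      (top_coeffs d B * preadjoint (top_coeffs d B)) $$ (t, s)"
    unfolding mult_preadjoint_index[OF B t s] mult_preadjoint_index[OF top t s]
    using summand by (simp add: lookup_sum lookup_of_int_mult)
qed

end

lemma deg_le_right_adjoint_prod:
  assumes B: "B \<in> carrier_mat n n" and deg: "\<And>i j. i < n \<Longrightarrow> j < n \<Longrightarrow> deg_le d (B $$ (i, j))"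
  shows "(\<forall>i<n. \<forall>j<n. deg_le (d * n ^ m) (right_adjoint_prod B m $$ (i, j))) \<and>
    top_coeffs (d * n ^ m) (right_adjoint_prod B m) = right_adjoint_prod (top_coeffs d B) m"
proof (induction m)
  case 0
  then show ?case using deg by simp
next
  case (Suc m)
  let ?C = "right_adjoint_prod B m" and ?d = "d * n ^ m"
  have C: "?C \<in> carrier_mat n n" by (rule right_adjoint_prod_carrier[OF B])
  have degC: "\<And>i j. i < n \<Longrightarrow> j < n \<Longrightarrow> deg_le ?d (?C $$ (i, j))" using Suc by blast
  have top: "top_coeffs ?d ?C \<in> carrier_mat n n" using C by (simp add: top_coeffs_def)
  have dim: "dim_row (top_coeffs ?d ?C) = n" "dim_col (top_coeffs ?d ?C) = n"
    "dim_row (preadjoint (top_coeffs ?d ?C)) = n" "dim_col (preadjoint (top_coeffs ?d ?C)) = n"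
    "dim_row ?C = n" "dim_col ?C = n" "dim_row (preadjoint ?C) = n" "dim_col (preadjoint ?C) = n"
    using carrier_matD[OF C] carrier_matD[OF top] carrier_matD[OF preadjoint_carrier[OF C]]
      carrier_matD[OF preadjoint_carrier[OF top]] by simp_all
  have "top_coeffs (?d * n) (?C * preadjoint ?C) = top_coeffs ?d ?C * preadjoint (top_coeffs ?d ?C)"
    using deg_le_mult_preadjoint(2)[OF C degC]
    by (intro eq_matI) (simp_all add: dim top_coeffs_def[of "?d * n"] del: index_mult_mat(1))
  with Suc deg_le_mult_preadjoint(1)[OF C degC] show ?case by (simp add: mult_ac)
qed

text \<open>Only the identity contributes, since a permutation fixing every index other than
  \<open>s\<close> fixes \<open>s\<close> too. The factorial counts the orderings of the remaining
  rows.\<close>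

lemma mult_preadjoint_scalar:
  assumes n: "0 < n"
  shows "(of_nat c \<cdot>\<^sub>m 1\<^sub>m n) * preadjoint (of_nat c \<cdot>\<^sub>m 1\<^sub>m n) =
    (of_nat (fact (n - 1) * c ^ n) \<cdot>\<^sub>m 1\<^sub>m n :: 'a::ring_1 mat)" (is "?C * _ = ?D")
proof (rule eq_matI)
  have C: "?C \<in> carrier_mat n n" by simp
  have word: "word ?C \<pi> \<rho> = (if \<forall>i\<in>set \<rho>. \<pi> i = i then of_nat (c ^ length \<rho>) else 0)"
    if "\<pi> permutes {..<n}" "set \<rho> \<subseteq> {..<n}" for \<pi> \<rho>
    using that(2) permutes_in_image[OF that(1)] by (induction \<rho>) auto
  fix t s assume "t < dim_row ?D" "s < dim_col ?D"
  then have t: "t < n" and s: "s < n" by simp_all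
  have "(\<Sum>\<pi> | \<pi> permutes {..<n}. of_int (sign \<pi>) * (?C $$ (t, \<pi> s) * word ?C \<pi> \<rho>)) =
      ?C $$ (t, s) * of_nat (c ^ (n - 1))"
    if \<rho>: "\<rho> \<in> permutations_of_set ({..<n} - {s})" for \<rho>
  proof -
    have set: "set \<rho> = {..<n} - {s}" and len: "length \<rho> = n - 1"
      using permutations_of_setD[OF \<rho>] distinct_card[of \<rho>] s by simp_all
    have "of_int (sign \<pi>) * (?C $$ (t, \<pi> s) * word ?C \<pi> \<rho>) =
        (if \<pi> = id then ?C $$ (t, s) * of_nat (c ^ (n - 1)) else 0)"
      if \<pi>: "\<pi> permutes {..<n}" for \<pi>
    proof (cases "\<forall>i\<in>set \<rho>. \<pi> i = i")
      case True
      have fix_off: "\<pi> i = i" if "i \<noteq> s" for i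
        using True that permutes_not_in[OF \<pi>, of i] set by (cases "i < n") auto
      then have "\<pi> s = s" using injD[OF permutes_inj[OF \<pi>], of "\<pi> s" s] by metis
      with fix_off have "\<pi> = id" by (intro ext) (metis id_apply)
      then show ?thesis using word[of id \<rho>] set len by (simp add: permutes_id)
    next
      case False
      then have "\<pi> \<noteq> id" by auto
      then show ?thesis using False word[OF \<pi>, of \<rho>] set by auto
    qed
    then have "(\<Sum>\<pi> | \<pi> permutes {..<n}. of_int (sign \<pi>) * (?C $$ (t, \<pi> s) * word ?C \<pi> \<rho>)) =
        (\<Sum>\<pi> | \<pi> permutes {..<n}. if \<pi> = id then ?C $$ (t, s) * of_nat (c ^ (n - 1)) else 0)"
      by (intro sum.cong refl) simp
    then show ?thesis by (simp add: finite_permutations permutes_id)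
  qed
  then have "(?C * preadjoint ?C) $$ (t, s) =
      of_nat (fact (n - 1)) * (?C $$ (t, s) * of_nat (c ^ (n - 1)))"
    using s by (simp add: mult_preadjoint_index[OF C t s])
  also have "\<dots> = ?D $$ (t, s)"
    using t s n by (cases n) (auto simp: mult.assoc)
  finally show "(?C * preadjoint ?C) $$ (t, s) = ?D $$ (t, s)" .
qed (use carrier_matD[OF preadjoint_carrier[OF smult_carrier_mat[OF one_carrier_mat]], of "of_nat c :: 'a" n]
    in simp_all)

text \<open>Each step sends the exponent \<open>e\<close> of the factorial to
  \<open>1 + n * e\<close>, which produces the geometric sum.\<close>

lemma right_adjoint_prod_one:
  assumes "0 < n"
  shows "right_adjoint_prod (1\<^sub>m n) m =
    (of_nat (fact (n - 1) ^ (\<Sum>j<m. n ^ j)) \<cdot>\<^sub>m 1\<^sub>m n :: 'a::ring_1 mat)"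
proof (induction m)
  case 0
  show ?case by (intro eq_matI) auto
next
  case (Suc m)
  have "(\<Sum>j<Suc m. n ^ j) = Suc ((\<Sum>j<m. n ^ j) * n)"
    by (subst sum.lessThan_Suc_shift) (simp add: sum_distrib_left mult.commute)
  then show ?case
    using mult_preadjoint_scalar[OF assms, of "fact (n - 1) ^ (\<Sum>j<m. n ^ j)", where 'a = 'a] Suc
    by (simp add: power_mult)
qed

section \<open>Transitive matrices and the endomorphism\<close>

lemma ring_centerD: "c \<in> ring_center \<Longrightarrow> c * x = x * c"
  by (simp add: ring_center_def)

lemma ring_center_mult:
  assumes c: "c \<in> ring_center" and d: "d \<in> ring_center"
  shows "c * d \<in> ring_center"
proof -
  have "c * d * x = x * (c * d)" for x
  proof -
    have "c * d * x = c * (x * d)" by (simp only: mult.assoc ring_centerD[OF d, of x])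
    also have "\<dots> = c * x * d" by (simp only: mult.assoc)
    also have "\<dots> = x * (c * d)" by (simp only: ring_centerD[OF c, of x] mult.assoc)
    finally show ?thesis .
  qed
  then show ?thesis by (simp add: ring_center_def)
qed

lemma ring_center_of_nat: "of_nat m \<in> ring_center"
  by (simp add: ring_center_def mult_of_nat_commute)

lemma ring_center_inverse:
  assumes c: "c \<in> ring_center" and "u * c = 1" and "c * u = 1"
  shows "u \<in> ring_center"
proof -
  have "u * x = x * u" for x
  proof -
    have "u * x = u * (x * c) * u" using assms(3) by (simp add: mult.assoc)
    also have "\<dots> = u * c * x * u" by (simp only: ring_centerD[OF c, of x, symmetric]) (simp only: mult.assoc)
    finally show ?thesis using assms(2) by simp
  qed
  then show ?thesis by (simp add: ring_center_def)
qed

lemma prod_list_mult_central: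
  assumes "\<And>i. i \<in> set xs \<Longrightarrow> h i \<in> ring_center"
  shows "prod_list (map (\<lambda>i. g i * h i) xs) = prod_list (map g xs) * prod_list (map h xs)"
  using assms
proof (induction xs)
  case (Cons x xs)
  have "h x * prod_list (map g xs) = prod_list (map g xs) * h x"
    by (rule ring_centerD) (simp add: Cons.prems)
  with Cons show ?case by simp (metis mult.assoc)
qed simp

lemma prod_list_mset_central:
  assumes "mset xs = mset ys" and "set xs \<subseteq> ring_center"
  shows "prod_list xs = prod_list ys"
  using assms
proof (induction xs arbitrary: ys)
  case (Cons x xs)
  then have "x \<in> set ys" by (metis list.set_intros(1) mset_eq_setD)
  then obtain u v where ys: "ys = u @ x # v" by (meson split_list)
  have "prod_list xs = prod_list (u @ v)" using Cons ys by (intro Cons.IH) auto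
  moreover have "x * prod_list u = prod_list u * x" using Cons.prems by (intro ring_centerD) simp
  ultimately show ?case unfolding ys by simp (metis mult.assoc)
qed simp

text \<open>Writing \<open>T $$ (i, j)\<close> as \<open>T $$ (i, 0) * T $$ (0, j)\<close> and
  reordering central factors shows that the product over all rows is 1. Leaving out row
  \<open>s\<close> thus gives the inverse of \<open>T $$ (s, \<pi> s)\<close>.\<close>

lemma word_transitive_mat:
  assumes T: "transitive_mat n T" and center: "\<forall>i<n. \<forall>j<n. T $$ (i, j) \<in> ring_center"
    and \<pi>: "\<pi> permutes {..<n}" and s: "s < n" and \<rho>: "\<rho> \<in> permutations_of_set ({..<n} - {s})"
  shows "word T \<pi> \<rho> = T $$ (\<pi> s, s)"
proof -
  have trans: "T $$ (i, j) * T $$ (j, l) = T $$ (i, l)" if "i < n" "j < n" "l < n" for i j l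
    using T that by (simp add: transitive_mat_def)
  have one: "T $$ (i, i) = 1" if "i < n" for i
    using T that by (simp add: transitive_mat_def)
  have n: "0 < n" using s by simp
  have in_n: "\<pi> i < n" if "i < n" for i using permutes_in_image[OF \<pi>, of i] that by simp
  let ?g = "\<lambda>i. T $$ (i, 0)" and ?h = "\<lambda>i. T $$ (0, i)" and ?xs = "s # \<rho>"
  have xs: "set ?xs = {..<n}" "distinct ?xs"
    using permutations_of_setD[OF \<rho>] s by auto
  have "mset (map \<pi> ?xs) = mset_set (\<pi> ` {..<n})"
    using xs permutes_inj_on[OF \<pi>, of "set ?xs"]
    by (metis distinct_map list.set_map mset_set_set)
  also have "\<dots> = mset ?xs" using xs by (metis mset_set_set permutes_image[OF \<pi>])
  finally have "mset (map ?h (map \<pi> ?xs)) = mset (map ?h ?xs)" by (simp only: mset_map)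
  then have perm: "prod_list (map ?h (map \<pi> ?xs)) = prod_list (map ?h ?xs)"
    using center xs n in_n by (intro prod_list_mset_central) auto
  have "T $$ (s, \<pi> s) * word T \<pi> \<rho> = word T \<pi> ?xs" by simp
  also have "\<dots> = prod_list (map (\<lambda>i. ?g i * ?h (\<pi> i)) ?xs)"
    unfolding word_def using xs n in_n
    by (intro arg_cong[of _ _ prod_list] map_cong refl) (metis lessThan_iff trans)
  also have "\<dots> = prod_list (map ?g ?xs) * prod_list (map (\<lambda>i. ?h (\<pi> i)) ?xs)"
    using center xs(1) n in_n by (intro prod_list_mult_central) blast
  also have "prod_list (map (\<lambda>i. ?h (\<pi> i)) ?xs) = prod_list (map ?h ?xs)"
    using perm by (simp add: o_def)
  also have "prod_list (map ?g ?xs) * prod_list (map ?h ?xs) = prod_list (map (\<lambda>i. ?g i * ?h i) ?xs)"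
    using center xs(1) n by (intro prod_list_mult_central[symmetric]) blast
  also have "\<dots> = prod_list (map (\<lambda>i. 1) ?xs)"
    using xs n trans one by (intro arg_cong[of _ _ prod_list] map_cong refl) (metis lessThan_iff)
  also have "\<dots> = 1" by (simp add: map_replicate_const)
  finally have "T $$ (\<pi> s, s) * (T $$ (s, \<pi> s) * word T \<pi> \<rho>) = T $$ (\<pi> s, s)" by simp
  then show ?thesis
    using trans[OF in_n[OF s] s in_n[OF s]] one[OF in_n[OF s]]
    by (simp add: mult.assoc[symmetric])
qed

text \<open>The entry condition of the supermatrix algebra for \<delta> extended to polynomials with
  the indeterminate fixed. Weight 1 means that all coefficients are fixed by \<delta>.\<close>

definition weighted :: "('a \<Rightarrow> 'a) \<Rightarrow> 'a::ring_1 \<Rightarrow> (nat \<Rightarrow>\<^sub>0 'a) \<Rightarrow> bool" where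
  "weighted \<delta> c p \<longleftrightarrow> (\<forall>i. \<delta> (Poly_Mapping.lookup p i) = c * Poly_Mapping.lookup p i)"

context
  fixes \<delta> :: "'a::ring_1 \<Rightarrow> 'a"
  assumes hom: "Ring_Hom.ring_hom \<delta>"
begin

lemma add_subgroup_weighted: "add_subgroup {p. weighted \<delta> c p}"
proof -
  interpret Ring_Hom.ring_hom \<delta> by (rule hom)
  show ?thesis by (simp add: add_subgroup_def weighted_def lookup_minus hom_minus right_diff_distrib)
qed

lemma weighted_mult:
  assumes "weighted \<delta> c p" and "weighted \<delta> d q" and "d \<in> ring_center"
  shows "weighted \<delta> (c * d) (p * q)"
proof -
  interpret Ring_Hom.ring_hom \<delta> by (rule hom)
  have "c * x * (d * y) = c * d * (x * y)" for x y
    using ring_centerD[OF assms(3), of x] by (metis mult.assoc)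
  with assms show ?thesis
    by (simp add: weighted_def lookup_times hom_sum hom_mult sum_distrib_left)
qed

lemma weighted_one: "weighted \<delta> 1 1"
proof -
  interpret Ring_Hom.ring_hom \<delta> by (rule hom)
  show ?thesis by (simp add: weighted_def lookup_one when_def)
qed

text \<open>Each summand has weight \<open>T $$ (t, \<pi> s) * T $$ (\<pi> s, s)\<close>, which is
  \<open>T $$ (t, s)\<close> whatever \<pi> and the ordering are, so the sum has this weight as
  well.\<close>

lemma weighted_mult_preadjoint:
  assumes B: "B \<in> carrier_mat n n"
    and T: "transitive_mat n T" and center: "\<forall>i<n. \<forall>j<n. T $$ (i, j) \<in> ring_center"
    and weight: "\<And>i j. i < n \<Longrightarrow> j < n \<Longrightarrow> weighted \<delta> (T $$ (i, j)) (B $$ (i, j))"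
    and t: "t < n" and s: "s < n"
  shows "weighted \<delta> (T $$ (t, s)) ((B * preadjoint B) $$ (t, s))"
proof -
  have word: "weighted \<delta> (word T \<pi> \<rho>) (word B \<pi> \<rho>) \<and> word T \<pi> \<rho> \<in> ring_center"
    if "set \<rho> \<subseteq> {..<n}" "\<pi> permutes {..<n}" for \<pi> \<rho>
    using that(1)
  proof (induction \<rho>)
    case Nil
    show ?case by (simp add: weighted_one) (simp add: ring_center_def)
  next
    case (Cons i \<rho>)
    then have "i < n" "\<pi> i < n" using permutes_in_image[OF that(2), of i] by auto
    with Cons show ?case by (simp add: weighted_mult weight ring_center_mult center)
  qed
  have summand: "weighted \<delta> (T $$ (t, s)) (B $$ (t, \<pi> s) * word B \<pi> \<rho>)"
    if \<pi>: "\<pi> permutes {..<n}" and \<rho>: "\<rho> \<in> permutations_of_set ({..<n} - {s})" for \<pi> \<rho>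
  proof -
    have \<pi>s: "\<pi> s < n" using permutes_in_image[OF \<pi>, of s] s by simp
    have sub: "set \<rho> \<subseteq> {..<n}" using permutations_of_setD(1)[OF \<rho>] by blast
    have "T $$ (t, \<pi> s) * word T \<pi> \<rho> = T $$ (t, s)"
      using T t s \<pi>s by (simp add: word_transitive_mat[OF T center \<pi> s \<rho>] transitive_mat_def)
    with weighted_mult[OF weight[OF t \<pi>s], of "word T \<pi> \<rho>" "word B \<pi> \<rho>"] word[OF sub \<pi>]
    show ?thesis by simp
  qed
  have "(B * preadjoint B) $$ (t, s) \<in> {p. weighted \<delta> (T $$ (t, s)) p}"
    unfolding mult_preadjoint_index[OF B t s]
    by (intro add_subgroup_sum[OF add_subgroup_weighted]
        add_subgroup_of_int_mult[OF add_subgroup_weighted] CollectI summand) auto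
  then show ?thesis by simp
qed

lemma weighted_right_adjoint_prod:
  assumes B: "B \<in> carrier_mat n n"
    and T: "transitive_mat n T" and center: "\<forall>i<n. \<forall>j<n. T $$ (i, j) \<in> ring_center"
    and weight: "\<And>i j. i < n \<Longrightarrow> j < n \<Longrightarrow> weighted \<delta> (T $$ (i, j)) (B $$ (i, j))"
  shows "i < n \<Longrightarrow> j < n \<Longrightarrow> weighted \<delta> (T $$ (i, j)) (right_adjoint_prod B m $$ (i, j))"
proof (induction m arbitrary: i j)
  case (Suc m)
  then show ?case
    using weighted_mult_preadjoint[OF right_adjoint_prod_carrier[OF B] T center Suc.IH] by simp
qed (simp add: weight)

lemma weighted_rdet:
  assumes B: "B \<in> carrier_mat n n"
    and T: "transitive_mat n T" and center: "\<forall>i<n. \<forall>j<n. T $$ (i, j) \<in> ring_center"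
    and weight: "\<And>i j. i < n \<Longrightarrow> j < n \<Longrightarrow> weighted \<delta> (T $$ (i, j)) (B $$ (i, j))"
  shows "weighted \<delta> 1 (rdet m B)"
proof -
  have "weighted \<delta> 1 (right_adjoint_prod B m $$ (i, i))" if "i < n" for i
    using weighted_right_adjoint_prod[OF B T center weight that that] T that
    by (simp add: transitive_mat_def)
  then have "(\<Sum>i<n. right_adjoint_prod B m $$ (i, i)) \<in> {p. weighted \<delta> 1 p}"
    by (intro add_subgroup_sum[OF add_subgroup_weighted]) simp
  moreover have "dim_row (right_adjoint_prod B m) = n"
    using right_adjoint_prod_carrier[OF B] by (rule carrier_matD)
  ultimately show ?thesis by (simp add: rdet_def mat_trace_def)
qed

end

section \<open>The right characteristic polynomial\<close>

definition char_mat :: "nat \<Rightarrow> 'a::ring_1 mat \<Rightarrow> (nat \<Rightarrow>\<^sub>0 'a) mat" where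
  "char_mat n A = Poly_Mapping.single 1 1 \<cdot>\<^sub>m 1\<^sub>m n - map_mat (Poly_Mapping.single 0) A"

lemma char_mat_carrier: "A \<in> carrier_mat n n \<Longrightarrow> char_mat n A \<in> carrier_mat n n"
  unfolding char_mat_def by (rule minus_carrier_mat) simp

lemma char_mat_index:
  "A \<in> carrier_mat n n \<Longrightarrow> i < n \<Longrightarrow> j < n \<Longrightarrow> char_mat n A $$ (i, j) =
    (if i = j then Poly_Mapping.single 1 1 else 0) - Poly_Mapping.single 0 (A $$ (i, j))"
  by (simp add: char_mat_def)

lemma right_char_poly_eq: "A \<in> carrier_mat n n \<Longrightarrow> right_char_poly k A = rdet k (char_mat n A)"
  by (simp add: right_char_poly_def char_mat_def)

text \<open>The matrix \<open>zI - A\<close> again has weights \<open>T\<close>: the indeterminate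
  occurs only on the diagonal, where the weight is 1. The trace collects diagonal entries, also of
  weight 1.\<close>

lemma weighted_right_char_poly:
  assumes hom: "Ring_Hom.ring_hom \<delta>"
    and T: "transitive_mat n T" and center: "\<forall>i<n. \<forall>j<n. T $$ (i, j) \<in> ring_center"
    and A: "A \<in> supermatrix_algebra n \<delta> T"
  shows "weighted \<delta> 1 (right_char_poly k A)"
proof -
  interpret Ring_Hom.ring_hom \<delta> by (rule hom)
  have Ac: "A \<in> carrier_mat n n"
    and \<delta>A: "\<And>i j. i < n \<Longrightarrow> j < n \<Longrightarrow> \<delta> (A $$ (i, j)) = T $$ (i, j) * A $$ (i, j)"
    using A by (auto simp: supermatrix_algebra_def)
  have "weighted \<delta> (T $$ (i, j)) (char_mat n A $$ (i, j))" if "i < n" "j < n" for i j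
    unfolding char_mat_index[OF Ac that] weighted_def
    using \<delta>A[OF that] T that
    by (auto simp: lookup_minus lookup_single when_def hom_minus transitive_mat_def
        right_diff_distrib hom_uminus)
  then show ?thesis
    unfolding right_char_poly_eq[OF Ac] by (intro weighted_rdet[OF hom char_mat_carrier[OF Ac] T center])
qed

text \<open>The matrix of top coefficients of \<open>zI - A\<close> is the identity, so the leading
  coefficient comes from the sequence started at the identity; the trace adds the factor
  \<open>n\<close>.\<close>

lemma right_char_poly_degree:
  fixes A :: "'a::ring_1 mat"
  assumes A: "A \<in> carrier_mat n n" and n: "0 < n"
  shows "deg_le (n ^ k) (right_char_poly k A)"
    and "Poly_Mapping.lookup (right_char_poly k A) (n ^ k) =
      of_nat (n * fact (n - 1) ^ (\<Sum>j<k. n ^ j))"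
proof -
  let ?B = "char_mat n A"
  have B: "?B \<in> carrier_mat n n" by (rule char_mat_carrier[OF A])
  have deg: "deg_le 1 (?B $$ (i, j))" if "i < n" "j < n" for i j
    unfolding char_mat_index[OF A that] by (auto simp: deg_le_def lookup_minus lookup_single when_def)
  have top: "top_coeffs 1 ?B = 1\<^sub>m n"
    using A carrier_matD[OF B]
    by (intro eq_matI) (auto simp: top_coeffs_def char_mat_index lookup_minus lookup_single when_def)
  have degk: "deg_le (n ^ k) (right_adjoint_prod ?B k $$ (i, j))" if "i < n" "j < n" for i j
    using deg_le_right_adjoint_prod[OF B deg, of k] that by simp
  have topk: "top_coeffs (n ^ k) (right_adjoint_prod ?B k) =
      of_nat (fact (n - 1) ^ (\<Sum>j<k. n ^ j)) \<cdot>\<^sub>m 1\<^sub>m n"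
    using conjunct2[OF deg_le_right_adjoint_prod[OF B deg, of k]]
    by (simp only: mult_1 top right_adjoint_prod_one[OF n])
  have dim: "dim_row (right_adjoint_prod ?B k) = n" "dim_col (right_adjoint_prod ?B k) = n"
    using carrier_matD[OF right_adjoint_prod_carrier[OF B]] by simp_all
  have p: "right_char_poly k A = (\<Sum>i<n. right_adjoint_prod ?B k $$ (i, i))"
    unfolding right_char_poly_eq[OF A] rdet_def mat_trace_def dim ..
  have "right_char_poly k A \<in> {p. deg_le (n ^ k) p}"
    unfolding p by (intro add_subgroup_sum[OF add_subgroup_deg_le]) (simp add: degk)
  then show "deg_le (n ^ k) (right_char_poly k A)" by simp
  have "Poly_Mapping.lookup (right_adjoint_prod ?B k $$ (i, i)) (n ^ k) =
      of_nat (fact (n - 1) ^ (\<Sum>j<k. n ^ j))" if "i < n" for i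
    using arg_cong[OF topk, of "\<lambda>M. M $$ (i, i)"] that dim by (simp add: top_coeffs_def)
  then show "Poly_Mapping.lookup (right_char_poly k A) (n ^ k) =
      of_nat (n * fact (n - 1) ^ (\<Sum>j<k. n ^ j))"
    unfolding p by (simp add: lookup_sum)
qed

section \<open>Right substitution and the Cayley-Hamilton identity\<close>

lemma finsum_ring_mat:
  fixes f :: "'b \<Rightarrow> 'a::ring_1 mat"
  assumes "finite F" and "\<And>x. x \<in> F \<Longrightarrow> f x \<in> carrier_mat n n"
  shows "finsum (ring_mat TYPE('a) n ()) f F = mat n n (\<lambda>ij. \<Sum>x\<in>F. f x $$ ij)"
  using assms
proof (induction F)
  case empty
  interpret semiring "ring_mat TYPE('a) n ()" by (rule semiring_mat)
  show ?case by (intro eq_matI) (auto simp: ring_mat_simps)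
next
  case (insert x F)
  interpret semiring "ring_mat TYPE('a) n ()" by (rule semiring_mat)
  have "f \<in> F \<rightarrow> carrier (ring_mat TYPE('a) n ())" "f x \<in> carrier (ring_mat TYPE('a) n ())"
    using insert.prems by (auto simp: ring_mat_simps)
  from finsum_insert[OF insert.hyps this] insert show ?case
    by (intro eq_matI) (auto simp: ring_mat_simps)
qed

lemma finsum_right_smult:
  fixes A :: "'a::ring_1 mat"
  assumes A: "A \<in> carrier_mat n n" and "finite F"
  shows "finsum (ring_mat TYPE('a) n ()) (\<lambda>i. (A ^\<^sub>m i) \<cdot>\<^sub>r c i) F =
    mat n n (\<lambda>ij. \<Sum>m\<in>F. (A ^\<^sub>m m) $$ ij * c m)"
proof -
  have "A ^\<^sub>m m \<in> carrier_mat n n" for m by (rule pow_carrier_mat[OF A])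
  note carrier_matD[OF this]
  then show ?thesis
    using assms by (subst finsum_ring_mat) (auto simp: right_smult_mat_def intro!: eq_matI)
qed

text \<open>Any finite set containing the support may serve as summation range. The telescoping sum
  uses a large initial segment, the final theorem the degree bound.\<close>

lemma right_subst_eq:
  assumes A: "A \<in> carrier_mat n n" and "finite F" and "Poly_Mapping.keys p \<subseteq> F"
  shows "right_subst A p = mat n n (\<lambda>ij. \<Sum>m\<in>F. (A ^\<^sub>m m) $$ ij * Poly_Mapping.lookup p m)"
proof -
  have dim: "dim_row A = n" using A by simp
  show ?thesis
    unfolding right_subst_def dim finsum_right_smult[OF A finite_keys]
    using assms by (auto intro!: eq_matI sum.mono_neutral_left simp: in_keys_iff)
qed

lemma keys_subset_deg_le: "deg_le d p \<Longrightarrow> Poly_Mapping.keys p \<subseteq> {..d}"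
  by (auto simp: deg_le_def in_keys_iff not_le[symmetric])

text \<open>Comparing coefficients in \<open>(zI - A) Q = b I\<close> turns \<open>A\<^sup>m \<lambda>\<^sub>m\<close> into a difference of consecutive
  terms, so the sum telescopes.\<close>
lemma right_Cayley_Hamilton:
  fixes A :: "'a::ring_1 mat"
  assumes A: "A \<in> carrier_mat n n" and k: "0 < k" and nil: "lcs k = {0::'a}"
  shows "right_subst A (right_char_poly k A) = 0\<^sub>m n n"
proof -
  let ?B = "char_mat n A" and ?p = "right_char_poly k A"
  let ?b = "right_adjoint_prod ?B k $$ (0, 0)"
  let ?l = "Poly_Mapping.lookup"
  have B: "?B \<in> carrier_mat n n" by (rule char_mat_carrier[OF A])
  note nilp = lcs_poly_eq_zero[OF nil]
  have p: "?p = of_nat n * ?b"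
    unfolding right_char_poly_eq[OF A] by (rule rdet_eq[OF B k nilp])
  obtain Q where Q: "Q \<in> carrier_mat n n" and BQ: "right_adjoint_prod ?B k = ?B * Q"
    by (rule right_adjoint_prod_factor[OF B])
  \<comment> \<open>\<open>R m\<close> is \<open>n\<close> times the coefficient matrix of
    \<open>z^(m-1)\<close> in \<open>Q\<close>, the factor \<open>n\<close> coming from
    \<open>p = n b\<close>. With this shift the comparison reads
    \<open>\<lambda>\<^sub>m I = R m - A * R (Suc m)\<close>, and \<open>R 0\<close>
    vanishes.\<close>
  define R where "R m = mat n n (\<lambda>ij. of_nat n * (if m = 0 then 0 else ?l (Q $$ ij) (m - 1)))"
    for m
  have R: "R m \<in> carrier_mat n n" for m by (simp add: R_def)
  have Am: "A ^\<^sub>m m \<in> carrier_mat n n" for m by (rule pow_carrier_mat[OF A])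
  have coeff: "(if i = j then ?l ?p m else 0) = R m $$ (i, j) - (A * R (Suc m)) $$ (i, j)"
    if i: "i < n" and j: "j < n" for i j m
  proof -
    have "(if i = j then ?b else 0) = right_adjoint_prod ?B k $$ (i, j)"
      by (rule right_adjoint_prod_scalar[OF B k nilp i j, symmetric])
    also have "\<dots> = (?B * Q) $$ (i, j)" by (simp only: BQ)
    also have "\<dots> = (\<Sum>l<n. ?B $$ (i, l) * Q $$ (l, j))"
      using i j carrier_matD[OF B] carrier_matD[OF Q]
      by (simp add: scalar_prod_def atLeast0LessThan)
    also have "\<dots> = (\<Sum>l<n. (if l = i then Poly_Mapping.single 1 1 * Q $$ (i, j) else 0)
        - Poly_Mapping.single 0 (A $$ (i, l)) * Q $$ (l, j))"
      by (intro sum.cong refl) (auto simp: char_mat_index[OF A i] left_diff_distrib)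
    also have "\<dots> = Poly_Mapping.single 1 1 * Q $$ (i, j)
        - (\<Sum>l<n. Poly_Mapping.single 0 (A $$ (i, l)) * Q $$ (l, j))"
      using i by (simp add: sum_subtractf)
    finally have "?l (if i = j then ?b else 0) m =
        (if m = 0 then 0 else ?l (Q $$ (i, j)) (m - 1)) - (\<Sum>l<n. A $$ (i, l) * ?l (Q $$ (l, j)) m)"
      using lookup_var_mult[of "Q $$ (i, j)" m]
      by (simp add: lookup_minus lookup_sum lookup_const_mult)
    moreover have "(if i = j then ?l ?p m else 0) = of_nat n * ?l (if i = j then ?b else 0) m"
      by (simp add: p lookup_of_nat_mult)
    moreover have "of_nat n * (A $$ (i, l) * x) = A $$ (i, l) * (of_nat n * x)" for l x
      by (metis mult.assoc mult_of_nat_commute)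
    then have "of_nat n * (\<Sum>l<n. A $$ (i, l) * ?l (Q $$ (l, j)) m) = (A * R (Suc m)) $$ (i, j)"
      using i j carrier_matD[OF A]
      by (simp add: R_def scalar_prod_def atLeast0LessThan sum_distrib_left)
    ultimately show ?thesis
      using i j by (simp add: R_def right_diff_distrib)
  qed
  \<comment> \<open>Exceeds every exponent in \<open>p\<close> and in the entries of
    \<open>Q\<close>; the 0 keeps the set nonempty. The sum stops at \<open>Suc N0\<close> because
    \<open>R (Suc N0)\<close> reads the coefficient of index \<open>N0\<close>.\<close>
  define N0 where "N0 = Suc (Max ({0} \<union> Poly_Mapping.keys ?p \<union>
    (\<Union>i<n. \<Union>j<n. Poly_Mapping.keys (Q $$ (i, j)))))"
  have bound: "m < N0" if "m \<in> Poly_Mapping.keys ?p \<union> (\<Union>i<n. \<Union>j<n. Poly_Mapping.keys (Q $$ (i, j)))" for m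
    unfolding N0_def less_Suc_eq_le using that by (intro Max_ge) auto
  let ?N = "Suc N0"
  have keys: "Poly_Mapping.keys ?p \<subseteq> {..<?N}" using bound by fastforce
  have RN: "R ?N = 0\<^sub>m n n"
  proof (intro eq_matI)
    fix i j assume "i < dim_row (0\<^sub>m n n :: 'a mat)" "j < dim_col (0\<^sub>m n n :: 'a mat)"
    then have ij: "i < n" "j < n" by simp_all
    then have "N0 \<notin> Poly_Mapping.keys (Q $$ (i, j))" using bound[of N0] by blast
    then show "R ?N $$ (i, j) = 0\<^sub>m n n $$ (i, j)" using ij by (simp add: R_def in_keys_iff)
  qed (simp_all add: R_def)
  have R0: "R 0 = 0\<^sub>m n n" by (intro eq_matI) (simp_all add: R_def)
  have step: "(A ^\<^sub>m m) $$ (i, j) * ?l ?p m =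
      (A ^\<^sub>m m * R m) $$ (i, j) - (A ^\<^sub>m Suc m * R (Suc m)) $$ (i, j)"
    if i: "i < n" and j: "j < n" for i j m
  proof -
    have AR: "A * R (Suc m) \<in> carrier_mat n n" by (rule mult_carrier_mat[OF A R])
    \<comment> \<open>The right multiple by \<lambda> is written as a product with the scalar
      matrix, whose entries \<open>coeff\<close> then replaces.\<close>
    have "(A ^\<^sub>m m) $$ (i, j) * ?l ?p m =
        (\<Sum>l<n. (A ^\<^sub>m m) $$ (i, l) * (if l = j then ?l ?p m else 0))"
      using j by (simp add: if_distrib cong: if_cong)
    also have "\<dots> = (\<Sum>l<n. (A ^\<^sub>m m) $$ (i, l) * (R m $$ (l, j) - (A * R (Suc m)) $$ (l, j)))"
      using coeff[OF _ j] by (intro sum.cong refl) simp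
    also have "\<dots> = (A ^\<^sub>m m * R m) $$ (i, j) - (A ^\<^sub>m m * (A * R (Suc m))) $$ (i, j)"
      using i j carrier_matD[OF Am] carrier_matD[OF R] carrier_matD[OF AR]
      by (simp add: scalar_prod_def atLeast0LessThan right_diff_distrib sum_subtractf
          del: index_mult_mat(2,3))
    also have "A ^\<^sub>m m * (A * R (Suc m)) = A ^\<^sub>m Suc m * R (Suc m)"
      using assoc_mult_mat[OF Am A R] by simp
    finally show ?thesis .
  qed
  have "(\<Sum>m<?N. (A ^\<^sub>m m) $$ (i, j) * ?l ?p m) = 0" if i: "i < n" and j: "j < n" for i j
  proof -
    have "(\<Sum>m<?N. (A ^\<^sub>m m) $$ (i, j) * ?l ?p m) =
        (A ^\<^sub>m 0 * R 0) $$ (i, j) - (A ^\<^sub>m ?N * R ?N) $$ (i, j)"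
      unfolding step[OF i j] by (rule sum_lessThan_telescope')
    also have "\<dots> = 0"
      unfolding R0 RN right_mult_zero_mat[OF Am] using i j by simp
    finally show ?thesis .
  qed
  then show ?thesis
    unfolding right_subst_eq[OF A finite_lessThan keys] by (intro eq_matI) simp_all
qed

theorem theorem4p4:
  fixes n k :: nat and \<delta> :: "'a::ring_1 \<Rightarrow> 'a" and T :: "'a mat"
  assumes "n \<ge> 1" and "k \<ge> 1"
    and "Ring_Hom.ring_hom \<delta>"
    and "transitive_mat n T"
    and "\<forall>i<n. \<forall>j<n. T $$ (i, j) \<in> ring_center"
    and "lie_nilpotent TYPE('a) k"
  shows "(\<forall>A \<in> supermatrix_algebra n \<delta> T.
      let p = right_char_poly k A in
        (\<forall>i > n ^ k. Poly_Mapping.lookup p i = 0) \<and>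
        Poly_Mapping.lookup p (n ^ k) = of_nat (n * fact (n - 1) ^ (\<Sum>j<k. n ^ j)) \<and>
        right_subst A p = finsum (ring_mat TYPE('a) n ())
          (\<lambda>i. (A ^\<^sub>m i) \<cdot>\<^sub>r Poly_Mapping.lookup p i) {..n ^ k} \<and>
        right_subst A p = 0\<^sub>m n n \<and>
        (\<forall>i \<le> n ^ k. Poly_Mapping.lookup p i \<in> Fix \<delta>)) \<and>
    (\<forall>u::'a.
      u * of_nat (n * fact (n - 1) ^ (\<Sum>j<k. n ^ j)) = 1 \<and>
      of_nat (n * fact (n - 1) ^ (\<Sum>j<k. n ^ j)) * u = 1 \<and>
      Fix \<delta> \<subseteq> ring_center \<longrightarrow>
      (\<forall>A \<in> supermatrix_algebra n \<delta> T. \<exists>q.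
        q = right_char_poly k A * Poly_Mapping.single 0 u \<and>
        Poly_Mapping.lookup q (n ^ k) = 1 \<and>
        (\<forall>i > n ^ k. Poly_Mapping.lookup q i = 0) \<and>
        (\<forall>i. Poly_Mapping.lookup q i \<in> ring_center) \<and>
        right_subst A q = 0\<^sub>m n n))"
proof -
  let ?N = "n * fact (n - 1) ^ (\<Sum>j<k. n ^ j)"
  have n: "0 < n" and k: "0 < k" using assms(1,2) by simp_all
  have carrier: "A \<in> carrier_mat n n" if "A \<in> supermatrix_algebra n \<delta> T" for A
    using that by (simp add: supermatrix_algebra_def)
  have high: "Poly_Mapping.lookup (right_char_poly k A) i = 0"
    if "A \<in> supermatrix_algebra n \<delta> T" "n ^ k < i" for A i
    using right_char_poly_degree(1)[OF carrier[OF that(1)] n, of k] that(2) by (simp add: deg_le_def)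
  have lead: "Poly_Mapping.lookup (right_char_poly k A) (n ^ k) = of_nat ?N"
    if "A \<in> supermatrix_algebra n \<delta> T" for A
    by (rule right_char_poly_degree(2)[OF carrier[OF that] n])
  have keys: "Poly_Mapping.keys (right_char_poly k A) \<subseteq> {..n ^ k}"
    if "A \<in> supermatrix_algebra n \<delta> T" for A
    by (rule keys_subset_deg_le[OF right_char_poly_degree(1)[OF carrier[OF that] n]])
  have CH: "right_subst A (right_char_poly k A) = 0\<^sub>m n n"
    if "A \<in> supermatrix_algebra n \<delta> T" for A
    by (rule right_Cayley_Hamilton[OF carrier[OF that] k lie_nilpotent_lcs[OF assms(6)]])
  have fixed: "Poly_Mapping.lookup (right_char_poly k A) i \<in> Fix \<delta>"
    if "A \<in> supermatrix_algebra n \<delta> T" for A i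
    using weighted_right_char_poly[OF assms(3-5) that, of k] by (simp add: weighted_def Fix_def)
  have integral: "\<exists>q. q = right_char_poly k A * Poly_Mapping.single 0 u \<and>
        Poly_Mapping.lookup q (n ^ k) = 1 \<and>
        (\<forall>i > n ^ k. Poly_Mapping.lookup q i = 0) \<and>
        (\<forall>i. Poly_Mapping.lookup q i \<in> ring_center) \<and>
        right_subst A q = 0\<^sub>m n n"
    if u: "u * of_nat ?N = 1" "of_nat ?N * u = 1" and sub: "Fix \<delta> \<subseteq> ring_center"
      and A: "A \<in> supermatrix_algebra n \<delta> T" for u :: 'a and A
  proof -
    let ?p = "right_char_poly k A"
    \<comment> \<open>Multiplying on the right by \<open>u\<close> makes the polynomial monic and
      lets \<open>u\<close> be pulled out of the right substitution.\<close>
    let ?q = "?p * Poly_Mapping.single 0 u"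
    \<comment> \<open>Here \<open>u\<close> inverts an integer multiple of 1, which is central. With
      \<open>Fix \<delta>\<close> inside the center this makes all coefficients of \<open>?q\<close>
      central.\<close>
    have "u \<in> ring_center" by (rule ring_center_inverse[OF ring_center_of_nat u])
    then have central: "Poly_Mapping.lookup ?q i \<in> ring_center" for i
      using fixed[OF A] sub by (auto simp: lookup_mult_const intro: ring_center_mult)
    have keysq: "Poly_Mapping.keys ?q \<subseteq> {..n ^ k}"
    proof
      fix m assume "m \<in> Poly_Mapping.keys ?q"
      then have "m \<in> Poly_Mapping.keys ?p" by (auto simp: in_keys_iff lookup_mult_const)
      with keys[OF A] show "m \<in> {..n ^ k}" by blast
    qed
    let ?M = "\<lambda>p. mat n n (\<lambda>ij. \<Sum>m\<le>n ^ k. (A ^\<^sub>m m) $$ ij * Poly_Mapping.lookup p m)"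
    have "?M ?p = 0\<^sub>m n n"
      using CH[OF A] unfolding right_subst_eq[OF carrier[OF A] finite_atMost keys[OF A]] .
    then have zero: "(\<Sum>m\<le>n ^ k. (A ^\<^sub>m m) $$ (i, j) * Poly_Mapping.lookup ?p m) = 0"
      if "i < n" "j < n" for i j
      using index_mat(1)[OF that, of "\<lambda>ij. \<Sum>m\<le>n ^ k. (A ^\<^sub>m m) $$ ij * Poly_Mapping.lookup ?p m"]
        index_zero_mat(1)[OF that, where 'a = 'a] by (simp only:)
    have "(\<Sum>m\<le>n ^ k. (A ^\<^sub>m m) $$ ij * Poly_Mapping.lookup ?q m) =
        (\<Sum>m\<le>n ^ k. (A ^\<^sub>m m) $$ ij * Poly_Mapping.lookup ?p m) * u" for ij
      by (simp add: lookup_mult_const sum_distrib_right mult.assoc)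
    with zero have "?M ?q = 0\<^sub>m n n" by (intro eq_matI) simp_all
    then have "right_subst A ?q = 0\<^sub>m n n"
      unfolding right_subst_eq[OF carrier[OF A] finite_atMost keysq] .
    then show ?thesis
      using central lead[OF A] high[OF A] u(2) by (simp add: lookup_mult_const)
  qed
  have expand: "right_subst A (right_char_poly k A) = finsum (ring_mat TYPE('a) n ())
      (\<lambda>i. (A ^\<^sub>m i) \<cdot>\<^sub>r Poly_Mapping.lookup (right_char_poly k A) i) {..n ^ k}"
    if "A \<in> supermatrix_algebra n \<delta> T" for A
    unfolding right_subst_eq[OF carrier[OF that] finite_atMost keys[OF that]]
      finsum_right_smult[OF carrier[OF that] finite_atMost] ..
  show ?thesis
    unfolding Let_def
    by (intro conjI ballI allI impI; (elim conjE)?;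
        (rule high lead expand CH fixed integral; assumption))
qed

end
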